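(* Let $\{x_k\}$ be the iterates of the preconditioned Lanczos+1 algorithm for $(A,B)$ (described in the context), $r_k=(A-\rho(x_k)B)x_k$ the residuals, and $\{p_k\}$ the $B$-normalized search directions. Suppose that the linear convergence assumption, the angle assumption, the polynomial assumption and the differentiability assumption (all stated in the context) hold. For each $k$, let $y_k^*$ denote the global minimizer of $\rho(\cdot)$ in $U_k$, and let $C_{k+1}$ be the constant (independent of $\theta_0$) for which $$\rho(x_{k+1})-\rho(y_{k+1}^* )\le \rho(x_k)-\rho(y_k^* )+C_{k+1}\sin\theta_{k+1}\sin^2\theta_0$$ if $\{p_0,\ldots,p_k\}$ are approximately conjugate. Then for any given $k\ge 3$ (and sufficiently small $\theta_0$), $$\rho(x_k)-\rho(y_k^* )\le \sum_{j=3}^k C_j\sin\theta_j\,\sin^2\theta_0,$$ and therefore $$\lim_{\theta_0\to 0}\frac{\rho(x_k)-\rho(y_k^* )}{\rho(x_k)-\lambda_1}\le \lim_{\theta_0\to 0}\frac{\sum_{j=3}^k C_j\sin\theta_j\sin^2\theta_0}{\underline{\xi}^k(\rho(f_0)-\lambda_1)\sin^2\theta_0}\le\lim_{\theta_0\to 0}\frac{(\underline{\xi}^{-1})^k\sum_{j=3}^k C_j\sin\theta_j}{\lambda_2-\lambda_1}=0 .$$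
   Context: **Setting.** $A,B\in\mathbb{R}^{n\times n}$ are symmetric, $B$ is positive definite. $\lambda_1<\lambda_2\le\cdots\le\lambda_n$ are the eigenvalues of the pencil $(A,B)$ with $B$-orthonormal eigenvectors $v_i$: $Av_i=\lambda_iBv_i$, $v_i^TBv_j=\delta_{ij}$. $(u,w)_B=u^TBw$, $\|u\|_B=(u^TBu)^{1/2}$, $\rho(x)=\frac{x^TAx}{x^TBx}$. $\mathcal{K}_m(C,u)=\mathrm{span}\{u,Cu,\ldots,C^{m-1}u\}$. Angles without subscript are Euclidean; the angle between a vector and a subspace is the smallest angle to nonzero vectors of the subspace. **Preconditioned Lanczos+1 algorithm.** Fix an SPD preconditioner $M\approx(A-\sigma B)^{-1}$ ($\sigma<\lambda_1$) and an integer $m>0$. Choose $x_0$ with $\|x_0\|_B=1$; always $\rho_k=\rho(x_k)$, $r_k=(A-\rho_kB)x_k$. For $k=0,1,2,\ldots$: 1. Form $G_k$ whose columns are $B$-normalized basis vectors of $M\mathcal{K}_m((A-\rho_kB)M,r_k)$. 2. Let $Q_0=[x_0,G_0]$ and $Q_k=[x_k,G_k,p_{k-1}]$ for $k>0$; let $w_k$ be an eigenvector for the lowest eigenvalue of $Q_k^TAQ_kw=\rho\,Q_k^TBQ_kw$. 3. $g_k=G_kw_k(2:m+1)$ (the combination of the columns of $G_k$ with coefficients given by entries $2,\dots,m+1$ of $w_k$), $\widetilde x_{k+1}=Q_kw_k$, $x_{k+1}=\widetilde x_{k+1}/\|\widetilde x_{k+1}\|_B$. 4. $\widetilde p_0=g_0$,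 and for $k>0$, $\widetilde p_k=g_k-\frac{p_{k-1}^T(A-\rho_{k-1}B)g_k}{p_{k-1}^T(A-\rho_{k-1}B)p_{k-1}}p_{k-1}$; $p_k=\widetilde p_k/\|\widetilde p_k\|_B$. **Notation.** $\theta_k=\angle(x_k,v_1)_B=\cos^{-1}\frac{(v_1,x_k)_B}{\|v_1\|_B\|x_k\|_B}$, and $x_k=v_1\cos\theta_k+f_k\sin\theta_k$ with $f_k\perp Bv_1$, $\|f_k\|_B=1$. $W_k=\mathrm{span}\{g_0,\ldots,g_{k-1}\}$, $U_k=\mathrm{span}\{x_0\}+W_k$. Asymptotics $\mathcal{O}(\cdot)$ are for $\theta_0\to0$, with $A,B,M,m$ and the iteration indices fixed and implied constants independent of $\theta_0$. **Approximately conjugate.** $\{p_0,\ldots,p_k\}$ are (pairwise) approximately conjugate if $p_i^T(A-\rho(x_i)B)p_j=\mathcal{O}(\sin\theta_j)$ for all $0\le j<i\le k$. **Global quasi-optimality.** $x_k\in U_k$ achieves global quasi-optimality if $\lim_{\theta_0\to0}\frac{\rho(x_k)-\rho(y_k^* )}{\rho(x_k)-\lambda_1}=0$, where $y_k^*$ is the global minimizer of $\rho$ in $U_k$. **Linear convergence assumption.** The algorithm started with $\rho(x_0)\in(\lambda_1,\lambda_2)$ converges precisely linearly to $\lambda_1$: there are constants $0<\underline{\xi}<\bar\xi<1$, independent of the progress of the algorithm (and of $\theta_0$), with $\underline{\xi}^{k-j}(\rho_j-\lambda_1)\le\rho_k-\lambda_1\le\bar\xi^{k-j}(\rho_j-\lambda_1)$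 for all $0\le j<k$. **Angle assumption.** There is a constant $\delta>0$, independent of $\theta_0$, such that $\angle(v_1,W_k)\ge\delta$ for all $k\ge1$. **Polynomial assumption.** Write $g_k=Mp^{(k)}_{m-1}((A-\rho_kB)M)r_k$, where $p^{(k)}_{m-1}$ is a real polynomial of degree at most $m-1$. For sufficiently small $\theta_0$ and all $0\le j<k$, $Mp^{(k)}_{m-1}((A-\rho_kB)M)=Mp^{(j)}_{m-1}((A-\rho_jB)M)+\mathcal{O}(\sin\theta_j)$. **Differentiability assumption.** For a given step $k\ge3$, if $x_k$ achieves global quasi-optimality, then, setting $\cos\angle(r_k,W_k)|_{\theta_0=0}=0$, the quantity $\cos\angle(r_k,W_k)$ is differentiable at $\theta_0=0$; that is, $\cos\angle(r_k,W_k)\le\mathcal{O}(\sin\theta_0)=\mathcal{O}(\sin\theta_\ell)$ ($1\le\ell\le k$) for sufficiently small $\theta_0$.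
   Formalization: The eigenvectors w_k are assumed scaled so that the B-norm of Q_k w_k stays bounded above and away from 0 as θ_0→0; with arbitrary scaling (e.g. all w_k multiplied by sin θ_0) the polynomial assumption is void and the claim fails for m ≥ 2. *)

theory Defs
  imports
    "HOL-Analysis.Analysis"
    "HOL-Computational_Algebra.Polynomial"
    "HOL-Library.Landau_Symbols"
begin

section \<open>Matrices, B-geometry, angles\<close>

definition spd :: "real^'n^'n \<Rightarrow> bool" where
  "spd B \<longleftrightarrow> transpose B = B \<and> (\<forall>u. u \<noteq> 0 \<longrightarrow> u \<bullet> (B *v u) > 0)"

definition inner_in :: "real^'n^'n \<Rightarrow> real^'n \<Rightarrow> real^'n \<Rightarrow> real" where
  "inner_in B u w = u \<bullet> (B *v w)"

definition norm_in :: "real^'n^'n \<Rightarrow> real^'n \<Rightarrow> real" where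
  "norm_in B u = sqrt (inner_in B u u)"

definition angle_in :: "real^'n^'n \<Rightarrow> real^'n \<Rightarrow> real^'n \<Rightarrow> real" where
  "angle_in B u w = arccos (inner_in B u w / (norm_in B u * norm_in B w))"

definition vec_angle :: "real^'n \<Rightarrow> real^'n \<Rightarrow> real" where
  "vec_angle u w = arccos (u \<bullet> w / (norm u * norm w))"

definition subspace_angle :: "real^'n \<Rightarrow> (real^'n) set \<Rightarrow> real" where
  "subspace_angle u W = Inf {vec_angle u w | w. w \<in> W \<and> w \<noteq> 0}"

definition rayleigh :: "real^'n^'n \<Rightarrow> real^'n^'n \<Rightarrow> real^'n \<Rightarrow> real" where
  "rayleigh A B u = (u \<bullet> (A *v u)) / (u \<bullet> (B *v u))"

text \<open>The shifted matrix \<open>A - \<rho>(u) B\<close>; the residual of \<open>u\<close> is this matrix applied to \<open>u\<close>.\<close>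

definition shifted :: "real^'n^'n \<Rightarrow> real^'n^'n \<Rightarrow> real^'n \<Rightarrow> real^'n^'n" where
  "shifted A B u = A - rayleigh A B u *\<^sub>R B"

definition residual :: "real^'n^'n \<Rightarrow> real^'n^'n \<Rightarrow> real^'n \<Rightarrow> real^'n" where
  "residual A B u = shifted A B u *v u"

definition rayleigh_minimizer ::
  "real^'n^'n \<Rightarrow> real^'n^'n \<Rightarrow> (real^'n) set \<Rightarrow> real^'n \<Rightarrow> bool" where
  "rayleigh_minimizer A B U y \<longleftrightarrow>
     y \<in> U \<and> y \<noteq> 0 \<and> (\<forall>u\<in>U. u \<noteq> 0 \<longrightarrow> rayleigh A B y \<le> rayleigh A B u)"

text \<open>Eigenvalues and eigenvectors are indexed by \<open>1, \<dots>, n\<close> with \<open>n = CARD('n)\<close>.\<close>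

definition pencil_eigensystem ::
  "real^'n^'n \<Rightarrow> real^'n^'n \<Rightarrow> (nat \<Rightarrow> real) \<Rightarrow> (nat \<Rightarrow> real^'n) \<Rightarrow> bool" where
  "pencil_eigensystem A B ev v \<longleftrightarrow>
     (\<forall>i\<in>{1..CARD('n)}. A *v v i = ev i *\<^sub>R (B *v v i)) \<and>
     (\<forall>i\<in>{1..CARD('n)}. \<forall>j\<in>{1..CARD('n)}. inner_in B (v i) (v j) = (if i = j then 1 else 0))"

text \<open>The product on \<^typ>\<open>real^'n^'n\<close> given by the type class \<^class>\<open>times\<close> is componentwise,
  so powers and polynomials of a matrix are written out with \<open>**\<close>.\<close>

definition mat_power :: "real^'n^'n \<Rightarrow> nat \<Rightarrow> real^'n^'n" where
  "mat_power C j = (((**) C) ^^ j) (mat 1)"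

definition mat_poly :: "real poly \<Rightarrow> real^'n^'n \<Rightarrow> real^'n^'n" where
  "mat_poly q C = (\<Sum>j\<le>degree q. coeff q j *\<^sub>R mat_power C j)"

definition krylov :: "nat \<Rightarrow> real^'n^'n \<Rightarrow> real^'n \<Rightarrow> (real^'n) set" where
  "krylov m C u = span ((\<lambda>j. mat_power C j *v u) ` {..<m})"


section \<open>The projected eigenvalue problem\<close>

text \<open>Tall matrices \<open>Q\<close> are lists of columns; their number of columns varies with the step.
  Square matrices of size \<open>l\<close> are functions of two indices below \<open>l\<close>, indices starting at 0.\<close>

definition lincomb_cols :: "(real^'n) list \<Rightarrow> (nat \<Rightarrow> real) \<Rightarrow> real^'n" where
  "lincomb_cols Q w = (\<Sum>i<length Q. w i *\<^sub>R (Q ! i))"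

definition projected :: "real^'n^'n \<Rightarrow> (real^'n) list \<Rightarrow> nat \<Rightarrow> nat \<Rightarrow> real" where
  "projected A Q i j = (Q ! i) \<bullet> (A *v (Q ! j))"

definition gen_eigenpair ::
  "nat \<Rightarrow> (nat \<Rightarrow> nat \<Rightarrow> real) \<Rightarrow> (nat \<Rightarrow> nat \<Rightarrow> real) \<Rightarrow> real \<Rightarrow> (nat \<Rightarrow> real) \<Rightarrow> bool" where
  "gen_eigenpair l S T \<mu> w \<longleftrightarrow>
     (\<exists>i<l. w i \<noteq> 0) \<and> (\<forall>i<l. (\<Sum>j<l. S i j * w j) = \<mu> * (\<Sum>j<l. T i j * w j))"

text \<open>If \<open>Q\<close> has linearly dependent columns then every real number is an eigenvalue of the
  projected pencil and there is no lowest one; so a lowest eigenvector exists only if \<open>Q\<close> has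
  full column rank.\<close>

definition lowest_eigenvector ::
  "nat \<Rightarrow> (nat \<Rightarrow> nat \<Rightarrow> real) \<Rightarrow> (nat \<Rightarrow> nat \<Rightarrow> real) \<Rightarrow> (nat \<Rightarrow> real) \<Rightarrow> bool" where
  "lowest_eigenvector l S T w \<longleftrightarrow>
     (\<exists>\<mu>. gen_eigenpair l S T \<mu> w \<and> (\<forall>\<nu> u. gen_eigenpair l S T \<nu> u \<longrightarrow> \<mu> \<le> \<nu>))"


section \<open>The preconditioned Lanczos+1 algorithm\<close>

text \<open>The algorithm leaves the basis \<open>G\<^sub>k\<close> and the eigenvector \<open>w\<^sub>k\<close> (hence its scaling) free, so
  a run records them: iterates \<open>x\<^sub>k\<close>, columns of \<open>G\<^sub>k\<close>, coefficients \<open>w\<^sub>k\<close>, normalized search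
  directions \<open>p\<^sub>k\<close>.\<close>

record ('n::finite) run =
  iter :: "nat \<Rightarrow> real^'n"
  basis :: "nat \<Rightarrow> (real^'n) list"
  coef :: "nat \<Rightarrow> nat \<Rightarrow> real"
  dir :: "nat \<Rightarrow> real^'n"

definition trial_cols :: "('n::finite) run \<Rightarrow> nat \<Rightarrow> (real^'n) list" where
  "trial_cols R k = iter R k # basis R k @ (if k = 0 then [] else [dir R (k - 1)])"

text \<open>\<open>g\<^sub>k\<close>, where \<open>coef R k 0\<close> is the coefficient of \<open>x\<^sub>k\<close>.\<close>

definition gvec :: "('n::finite) run \<Rightarrow> nat \<Rightarrow> real^'n" where
  "gvec R k = lincomb_cols (basis R k) (\<lambda>i. coef R k (Suc i))"

text \<open>The unnormalized next iterate, \<open>Q\<^sub>k w\<^sub>k\<close>.\<close>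

definition ritz_vec :: "('n::finite) run \<Rightarrow> nat \<Rightarrow> real^'n" where
  "ritz_vec R k = lincomb_cols (trial_cols R k) (coef R k)"

definition dir_unnorm :: "real^'n^'n \<Rightarrow> real^'n^'n \<Rightarrow> ('n::finite) run \<Rightarrow> nat \<Rightarrow> real^'n" where
  "dir_unnorm A B R k =
     (if k = 0 then gvec R 0
      else gvec R k -
        (dir R (k - 1) \<bullet> (shifted A B (iter R (k - 1)) *v gvec R k) /
         (dir R (k - 1) \<bullet> (shifted A B (iter R (k - 1)) *v dir R (k - 1)))) *\<^sub>R dir R (k - 1))"

text \<open>\<open>R\<close> follows the algorithm in the steps \<open>0, \<dots>, K - 1\<close>, which produce \<open>x\<^sub>1, \<dots>, x\<^sub>K\<close>.\<close>

definition lanczos_plus_one ::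
  "real^'n^'n \<Rightarrow> real^'n^'n \<Rightarrow> real^'n^'n \<Rightarrow> nat \<Rightarrow> nat \<Rightarrow> ('n::finite) run \<Rightarrow> bool" where
  "lanczos_plus_one A B M m K R \<longleftrightarrow>
     norm_in B (iter R 0) = 1 \<and>
     (\<forall>k<K.
        length (basis R k) = m \<and> distinct (basis R k) \<and> independent (set (basis R k)) \<and>
        span (set (basis R k)) =
          (\<lambda>u. M *v u) ` krylov m (shifted A B (iter R k) ** M) (residual A B (iter R k)) \<and>
        (\<forall>u\<in>set (basis R k). norm_in B u = 1) \<and>
        lowest_eigenvector (length (trial_cols R k))
          (projected A (trial_cols R k)) (projected B (trial_cols R k)) (coef R k) \<and>
        iter R (Suc k) = (1 / norm_in B (ritz_vec R k)) *\<^sub>R ritz_vec R k \<and>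
        dir R k = (1 / norm_in B (dir_unnorm A B R k)) *\<^sub>R dir_unnorm A B R k)"

definition Wspace :: "('n::finite) run \<Rightarrow> nat \<Rightarrow> (real^'n) set" where
  "Wspace R k = span (gvec R ` {..<k})"

definition Uspace :: "('n::finite) run \<Rightarrow> nat \<Rightarrow> (real^'n) set" where
  "Uspace R k = {a + b | a b. a \<in> span {iter R 0} \<and> b \<in> Wspace R k}"

text \<open>\<open>\<theta>\<^sub>k\<close>, relative to the eigenvector \<open>v\<^sub>1\<close> given as second argument.\<close>

definition theta :: "real^'n^'n \<Rightarrow> real^'n \<Rightarrow> ('n::finite) run \<Rightarrow> nat \<Rightarrow> real" where
  "theta B v1 R k = angle_in B v1 (iter R k)"

abbreviation rho :: "real^'n^'n \<Rightarrow> real^'n^'n \<Rightarrow> ('n::finite) run \<Rightarrow> nat \<Rightarrow> real" where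
  "rho A B R k \<equiv> rayleigh A B (iter R k)"


section \<open>Asymptotic notions and assumptions\<close>

text \<open>The limit \<open>\<theta>\<^sub>0 \<longrightarrow> 0\<close> is taken over a family \<open>R\<close> of runs with respect to a filter \<open>F\<close> on its
  index type, along which \<open>\<theta>\<^sub>0\<close> tends to 0 through positive values. "For sufficiently small
  \<open>\<theta>\<^sub>0\<close>" means eventually along \<open>F\<close>, and constants implied by Landau symbols are uniform over
  the members of the family.

  The assumptions are imposed on the steps that lead to a given iterate \<open>x\<^sub>K\<close> only. Imposed for
  all steps at once they would be contradictory: near-orthogonality of \<open>r\<^sub>k\<close> to \<open>W\<^sub>k\<close> makes \<open>W\<^sub>k\<close>
  grow until it is the whole space and contains \<open>v\<^sub>1\<close>.\<close>

definition approx_conjugate ::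
  "'i filter \<Rightarrow> real^'n^'n \<Rightarrow> real^'n^'n \<Rightarrow> real^'n \<Rightarrow> ('i \<Rightarrow> ('n::finite) run) \<Rightarrow> nat \<Rightarrow> bool" where
  "approx_conjugate F A B v1 R k \<longleftrightarrow>
     (\<forall>i\<le>k. \<forall>j<i.
        (\<lambda>t. dir (R t) i \<bullet> (shifted A B (iter (R t) i) *v dir (R t) j))
          \<in> O[F](\<lambda>t. sin (theta B v1 (R t) j)))"

text \<open>Here \<open>y t k\<close> is a global minimizer of the Rayleigh quotient in \<open>U\<^sub>k\<close> and \<open>l1\<close> is the lowest
  eigenvalue.\<close>

definition quasi_optimal ::
  "'i filter \<Rightarrow> real^'n^'n \<Rightarrow> real^'n^'n \<Rightarrow> real \<Rightarrow> ('i \<Rightarrow> ('n::finite) run)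
     \<Rightarrow> ('i \<Rightarrow> nat \<Rightarrow> real^'n) \<Rightarrow> nat \<Rightarrow> bool" where
  "quasi_optimal F A B l1 R y k \<longleftrightarrow>
     ((\<lambda>t. (rho A B (R t) k - rayleigh A B (y t k)) / (rho A B (R t) k - l1)) \<longlongrightarrow> 0) F"

definition linear_convergence ::
  "'i filter \<Rightarrow> real^'n^'n \<Rightarrow> real^'n^'n \<Rightarrow> real \<Rightarrow> real \<Rightarrow> real \<Rightarrow> real
     \<Rightarrow> ('i \<Rightarrow> ('n::finite) run) \<Rightarrow> nat \<Rightarrow> bool" where
  "linear_convergence F A B l1 l2 \<xi>l \<xi>u R K \<longleftrightarrow>
     0 < \<xi>l \<and> \<xi>l < \<xi>u \<and> \<xi>u < 1 \<and>
     (\<forall>\<^sub>F t in F. rho A B (R t) 0 \<in> {l1<..<l2} \<longrightarrow>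
        (\<forall>k\<le>K. \<forall>j<k.
           \<xi>l ^ (k - j) * (rho A B (R t) j - l1) \<le> rho A B (R t) k - l1 \<and>
           rho A B (R t) k - l1 \<le> \<xi>u ^ (k - j) * (rho A B (R t) j - l1)))"

definition angle_assumption ::
  "'i filter \<Rightarrow> real^'n \<Rightarrow> ('i \<Rightarrow> ('n::finite) run) \<Rightarrow> nat \<Rightarrow> bool" where
  "angle_assumption F v1 R K \<longleftrightarrow>
     (\<exists>\<delta>>0. \<forall>\<^sub>F t in F. \<forall>k\<in>{1..K}. \<delta> \<le> subspace_angle v1 (Wspace (R t) k))"

definition precond_poly ::
  "real^'n^'n \<Rightarrow> real^'n^'n \<Rightarrow> real^'n^'n \<Rightarrow> real poly \<Rightarrow> real^'n \<Rightarrow> real^'n^'n" where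
  "precond_poly A B M q u = M ** mat_poly q (shifted A B u ** M)"

definition polynomial_assumption ::
  "'i filter \<Rightarrow> real^'n^'n \<Rightarrow> real^'n^'n \<Rightarrow> real^'n^'n \<Rightarrow> nat \<Rightarrow> real^'n
     \<Rightarrow> ('i \<Rightarrow> ('n::finite) run) \<Rightarrow> nat \<Rightarrow> bool" where
  "polynomial_assumption F A B M m v1 R K \<longleftrightarrow>
     (\<exists>q :: 'i \<Rightarrow> nat \<Rightarrow> real poly.
        (\<forall>\<^sub>F t in F. \<forall>k<K. degree (q t k) \<le> m - 1 \<and>
           gvec (R t) k =
             precond_poly A B M (q t k) (iter (R t) k) *v residual A B (iter (R t) k)) \<and>
        (\<forall>k<K. \<forall>j<k.
           (\<lambda>t. norm (precond_poly A B M (q t k) (iter (R t) k) -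
                       precond_poly A B M (q t j) (iter (R t) j)))
             \<in> O[F](\<lambda>t. sin (theta B v1 (R t) j))))"

text \<open>The scaling of the eigenvector \<open>w\<^sub>k\<close>, which scales \<open>g\<^sub>k\<close> and the polynomial representing it,
  does not affect the iterates. Bounds on differences of these polynomials have no content unless
  the scaling is fixed up to constants (scaling all \<open>w\<^sub>k\<close> by \<open>sin \<theta>\<^sub>0\<close> would make them hold for
  free). The convention is that \<open>Q\<^sub>k w\<^sub>k\<close> has size of order 1, as is the case, e.g., if it has
  unit norm or if the coefficient of \<open>x\<^sub>k\<close> is 1.\<close>

definition scaling_convention ::
  "'i filter \<Rightarrow> real^'n^'n \<Rightarrow> ('i \<Rightarrow> ('n::finite) run) \<Rightarrow> nat \<Rightarrow> bool" where
  "scaling_convention F B R K \<longleftrightarrow>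
     (\<forall>k<K. (\<lambda>t. norm_in B (ritz_vec (R t) k)) \<in> \<Theta>[F](\<lambda>_. 1))"

definition differentiability_assumption ::
  "'i filter \<Rightarrow> real^'n^'n \<Rightarrow> real^'n^'n \<Rightarrow> real \<Rightarrow> real^'n
     \<Rightarrow> ('i \<Rightarrow> ('n::finite) run) \<Rightarrow> ('i \<Rightarrow> nat \<Rightarrow> real^'n) \<Rightarrow> nat \<Rightarrow> bool" where
  "differentiability_assumption F A B l1 v1 R y k \<longleftrightarrow>
     (quasi_optimal F A B l1 R y k \<longrightarrow>
        (\<lambda>t. cos (subspace_angle (residual A B (iter (R t) k)) (Wspace (R t) k)))
          \<in> O[F](\<lambda>t. sin (theta B v1 (R t) 0)))"

end

theory Submission
  imports Defs
begin

text \<open>Near the eigenvector \<open>v\<^sub>1\<close> the algorithm is a perturbed conjugate gradient iteration for the form of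
  \<open>A - \<lambda>\<^sub>1 B\<close>. With \<open>\<epsilon> = sin \<theta>\<^sub>0\<close>, linear convergence over a fixed number of steps makes every
  \<open>sin \<theta>\<^sub>j\<close> and every residual \<open>r\<^sub>j\<close> of exact order \<open>\<epsilon>\<close>, and every \<open>\<rho>\<^sub>j - \<lambda>\<^sub>1\<close> of exact order
  \<open>\<epsilon>\<^sup>2\<close>; so the shifted matrices \<open>N\<^sub>j = A - \<rho>\<^sub>j B\<close> of different steps agree up to \<open>O(\<epsilon>\<^sup>2)\<close>. The
  growth of \<open>\<rho>(x\<^sub>j) - \<rho>(y\<^sub>j\<^sup>*)\<close> from step to step is given once \<open>p\<^sub>0, \<dots>, p\<^sub>j\<close> are approximately
  conjugate, and it starts at \<open>0\<close> for \<open>j = 2\<close> because the trial space of the second step contains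
  \<open>U\<^sub>2\<close> (\<open>Uspace_2_subset_trial\<close>). Hence the theorem is a statement about approximate conjugacy, which
  is proved by an induction that runs in parallel with the bound (\<open>excess_le_and_conjugate\<close>).

  Write \<open>s\<^sub>j x\<^sub>j\<^sub>+\<^sub>1 = a\<^sub>j x\<^sub>j + h\<^sub>j\<close> with \<open>s\<^sub>j\<close> the norm of the Ritz vector; then
  \<open>h\<^sub>j = g\<^sub>j + \<omega>\<^sub>j p\<^sub>j\<^sub>-\<^sub>1\<close> lies in \<open>W\<^sub>j\<^sub>+\<^sub>1\<close>. As \<open>x\<^sub>j\<close> and \<open>x\<^sub>j\<^sub>+\<^sub>1\<close> are both close to multiples of
  \<open>v\<^sub>1\<close>, the angle assumption gives \<open>h\<^sub>j = O(\<epsilon>)\<close> (\<open>h_vanishes\<close>); as \<open>r\<^sub>j\<^sub>+\<^sub>1\<close> is orthogonal to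
  \<open>M r\<^sub>j\<close>, the step cannot be of smaller order (\<open>h_exceeds\<close>). Both \<open>r\<^sub>j\<close> and \<open>r\<^sub>j\<^sub>+\<^sub>1\<close> are orthogonal
  to \<open>p\<^sub>j\<^sub>-\<^sub>1\<close>, so the unnormalized direction agrees with \<open>h\<^sub>j\<close> up to \<open>O(\<epsilon>\<^sup>2)\<close>
  (\<open>dir_unnorm_near_update\<close>). Therefore \<open>N\<^sub>i p\<^sub>j\<close> is, up to \<open>O(\<epsilon>)\<close>, a combination of
  \<open>r\<^sub>j\<^sub>+\<^sub>1\<close> and \<open>r\<^sub>j\<close> with coefficients of order \<open>1 / \<epsilon>\<close> (\<open>dir_image_error_vanishes\<close>).

  By the polynomial assumption \<open>g\<^sub>i = P\<^sub>i r\<^sub>i\<close> for symmetric matrices with \<open>P\<^sub>i - P\<^sub>j = O(\<epsilon>)\<close>, whence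
  \<open>g\<^sub>i\<^sup>T r\<^sub>j = r\<^sub>i\<^sup>T g\<^sub>j + O(\<epsilon>\<^sup>3)\<close> for \<open>j < i\<close> (\<open>gvec_residual_swap\<close>). Only differences of the \<open>P\<^sub>i\<close> are
  controlled, and the bound \<open>g\<^sub>i = O(\<epsilon>)\<close> has to be extracted from near-conjugacy of \<open>g\<^sub>i\<close> and
  \<open>p\<^sub>i\<^sub>-\<^sub>1\<close> (\<open>g_vanishes\<close>). If \<open>r\<^sub>i\<^sup>T g\<^sub>j = O(\<epsilon>\<^sup>3)\<close> for all \<open>j < i\<close>, the two relations combine to
  \<open>p\<^sub>i\<^sup>T N\<^sub>i p\<^sub>j = O(\<epsilon>)\<close> (\<open>nearly_conjugate_step\<close>). For \<open>i \<le> 2\<close> these inner products are zero; for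
  \<open>i \<ge> 3\<close> the bound at step \<open>i\<close> makes \<open>x\<^sub>i\<close> quasi-optimal, since it is \<open>O(\<epsilon>\<^sup>3)\<close> while \<open>\<rho>\<^sub>i - \<lambda>\<^sub>1\<close>
  has order \<open>\<epsilon>\<^sup>2\<close>, and then the differentiability assumption makes \<open>r\<^sub>i\<close> nearly orthogonal to
  \<open>W\<^sub>i\<close>.\<close>

section \<open>Matrices and quadratic forms\<close>

lemma symmetric_inner:
  fixes A :: "real^'n^'n"
  assumes "transpose A = A"
  shows "(A *v x) \<bullet> y = x \<bullet> (A *v y)"
  by (metis assms dot_lmul_matrix transpose_matrix_vector)

lemma symmetric_shifted:
  assumes "transpose A = A" and "transpose B = B"
  shows "transpose (shifted A B u) = shifted A B u"
  using assms by (simp add: shifted_def transpose_def vec_eq_iff)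

lemma shifted_mult: "shifted A B u *v x = A *v x - rayleigh A B u *\<^sub>R (B *v x)"
  by (simp add: shifted_def matrix_vector_mult_diff_rdistrib scaleR_matrix_vector_assoc)

lemma bounded_bilinear_matrix_vector:
  "bounded_bilinear ((*v) :: real^'n^'m \<Rightarrow> real^'n \<Rightarrow> real^'m)"
proof -
  have "bilinear ((*v) :: real^'n^'m \<Rightarrow> real^'n \<Rightarrow> real^'m)"
    by (auto simp: bilinear_def intro!: linearI
        simp: matrix_vector_mult_add_rdistrib matrix_vector_right_distrib
        scaleR_matrix_vector_assoc matrix_vector_mult_scaleR)
  then show ?thesis by (simp add: bilinear_conv_bounded_bilinear)
qed

lemma spd_inner_pos: "spd B \<Longrightarrow> u \<noteq> 0 \<Longrightarrow> u \<bullet> (B *v u) > 0"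
  by (simp add: spd_def)

lemma spd_coercive:
  fixes B :: "real^'n^'n"
  assumes "spd B"
  shows "\<exists>b>0. \<forall>u. b * (norm u)\<^sup>2 \<le> u \<bullet> (B *v u)"
proof -
  let ?f = "\<lambda>u. u \<bullet> (B *v u)"
  have cont: "continuous_on (sphere 0 1) ?f"
    by (intro continuous_intros linear_continuous_on matrix_vector_mul_bounded_linear)
  have "\<exists>z\<in>sphere 0 1. \<forall>u\<in>sphere 0 1. ?f z \<le> ?f u"
    using cont by (intro continuous_attains_inf) auto
  then obtain z :: "real^'n" where z: "norm z = 1" "\<And>u. norm u = 1 \<Longrightarrow> ?f z \<le> ?f u" by auto
  have "?f z * (norm u)\<^sup>2 \<le> ?f u" for u
  proof (cases "u = 0")
    case False
    have "?f z \<le> ?f (u /\<^sub>R norm u)" using False by (intro z(2)) auto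
    also have "\<dots> = ?f u / (norm u)\<^sup>2"
      by (simp add: matrix_vector_mult_scaleR power2_eq_square divide_inverse)
    finally show ?thesis using False by (simp add: pos_le_divide_eq)
  qed simp
  moreover have "?f z > 0" using z(1) assms by (intro spd_inner_pos) auto
  ultimately show ?thesis by blast
qed

lemma norm_in_sq: "spd B \<Longrightarrow> (norm_in B u)\<^sup>2 = u \<bullet> (B *v u)"
  by (cases "u = 0") (auto simp: norm_in_def inner_in_def spd_inner_pos less_imp_le)

lemma norm_in_nonneg: "spd B \<Longrightarrow> 0 \<le> norm_in B u"
  by (cases "u = 0") (auto simp: norm_in_def inner_in_def spd_inner_pos less_imp_le)

lemma norm_in_eq_0_iff: "spd B \<Longrightarrow> norm_in B u = 0 \<longleftrightarrow> u = 0"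
  by (metis inner_zero_left norm_in_sq less_irrefl power_zero_numeral spd_inner_pos zero_eq_power2)

lemma norm_in_scaleR: "spd B \<Longrightarrow> norm_in B (c *\<^sub>R u) = \<bar>c\<bar> * norm_in B u"
  by (simp add: norm_in_def inner_in_def matrix_vector_mult_scaleR real_sqrt_mult
      mult.assoc[symmetric] flip: power2_eq_square)

lemma norm_in_normalize: "spd B \<Longrightarrow> u \<noteq> 0 \<Longrightarrow> norm_in B ((1 / norm_in B u) *\<^sub>R u) = 1"
  using norm_in_eq_0_iff[of B u] norm_in_nonneg[of B u] by (simp add: norm_in_scaleR)

lemma norm_in_equivalent:
  assumes "spd B"
  obtains b c where "b > 0" "c > 0" "\<And>u. b * norm u \<le> norm_in B u" "\<And>u. norm_in B u \<le> c * norm u"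
proof -
  obtain b where b: "b > 0" "\<And>u. b * (norm u)\<^sup>2 \<le> u \<bullet> (B *v u)" using spd_coercive[OF assms] by auto
  obtain K where K: "K > 0" "\<And>x. norm (B *v x) \<le> norm x * K"
    using bounded_linear.pos_bounded[OF matrix_vector_mul_bounded_linear[of B]] by blast
  have 1: "sqrt b * norm u \<le> norm_in B u" for u
  proof (rule power2_le_imp_le)
    show "(sqrt b * norm u)\<^sup>2 \<le> (norm_in B u)\<^sup>2"
      using b by (simp add: norm_in_sq[OF assms] power_mult_distrib)
  qed (rule norm_in_nonneg[OF assms])
  have 2: "norm_in B u \<le> sqrt K * norm u" for u
  proof (rule power2_le_imp_le)
    have "u \<bullet> (B *v u) \<le> norm u * norm (B *v u)" by (rule norm_cauchy_schwarz)
    also have "\<dots> \<le> norm u * (norm u * K)" by (intro mult_left_mono K) auto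
    also have "\<dots> = (sqrt K * norm u)\<^sup>2"
      using K(1) by (simp add: power_mult_distrib) (simp add: power2_eq_square)
    finally show "(norm_in B u)\<^sup>2 \<le> (sqrt K * norm u)\<^sup>2" by (simp add: norm_in_sq[OF assms])
  qed (use K in simp)
  show ?thesis by (rule that[OF _ _ 1 2]) (use b K in auto)
qed

lemma rayleigh_scaleR: "c \<noteq> 0 \<Longrightarrow> rayleigh A B (c *\<^sub>R u) = rayleigh A B u"
  by (simp add: rayleigh_def matrix_vector_mult_scaleR)

lemma residual_orthogonal: "spd B \<Longrightarrow> u \<noteq> 0 \<Longrightarrow> u \<bullet> residual A B u = 0"
  using spd_inner_pos[of B u]
  by (simp add: residual_def shifted_mult rayleigh_def inner_diff_right)


section \<open>Polynomial preconditioners are symmetric\<close>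

lemma mat_power_Suc: "mat_power C (Suc j) = C ** mat_power C j"
  by (simp add: mat_power_def)

lemma mat_power_commute: "mat_power C j ** C = C ** mat_power C j"
  by (induction j) (simp_all add: mat_power_Suc mat_power_def[of _ 0] flip: matrix_mul_assoc)

lemma mat_power_self_adjoint:
  fixes M N :: "real^'n^'n"
  assumes "transpose M = M" and "transpose N = N"
  shows "(M *v (mat_power (N ** M) j *v x)) \<bullet> y = x \<bullet> (M *v (mat_power (N ** M) j *v y))"
proof (induction j arbitrary: x y)
  case 0
  show ?case by (simp add: mat_power_def symmetric_inner[OF assms(1)])
next
  case (Suc j)
  let ?C = "N ** M"
  have "(M *v (mat_power ?C (Suc j) *v x)) \<bullet> y = (M *v (N *v (M *v (mat_power ?C j *v x)))) \<bullet> y"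
    by (simp add: mat_power_Suc flip: matrix_vector_mul_assoc)
  also have "\<dots> = (M *v (mat_power ?C j *v x)) \<bullet> (?C *v y)"
    by (simp add: symmetric_inner[OF assms(1)] symmetric_inner[OF assms(2)] flip: matrix_vector_mul_assoc)
  also have "\<dots> = x \<bullet> (M *v (mat_power ?C j *v (?C *v y)))" by (rule Suc)
  also have "\<dots> = x \<bullet> (M *v (mat_power ?C (Suc j) *v y))"
    by (simp only: matrix_vector_mul_assoc mat_power_commute mat_power_Suc)
  finally show ?case .
qed

text \<open>Each term \<open>M (N M)\<^sup>j\<close> is a palindrome in the symmetric matrices \<open>M\<close> and \<open>N\<close>.\<close>

lemma precond_poly_self_adjoint:
  fixes M :: "real^'n^'n"
  assumes "transpose A = A" and "transpose B = B" and "transpose M = M"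
  shows "(precond_poly A B M q u *v x) \<bullet> y = x \<bullet> (precond_poly A B M q u *v y)"
proof -
  let ?C = "shifted A B u ** M"
  have sum_apply: "(\<Sum>j\<in>J. c j *\<^sub>R D j) *v z = (\<Sum>j\<in>J. c j *\<^sub>R (D j *v z))"
    for c :: "nat \<Rightarrow> real" and D :: "nat \<Rightarrow> real^'n^'n" and z J
    by (induction J rule: infinite_finite_induct)
      (simp_all add: matrix_vector_mult_add_rdistrib scaleR_matrix_vector_assoc)
  have expand: "precond_poly A B M q u *v z
      = (\<Sum>j\<le>degree q. coeff q j *\<^sub>R (M *v (mat_power ?C j *v z)))" for z
    by (simp add: precond_poly_def mat_poly_def sum_apply linear_sum[OF matrix_vector_mul_linear]
        matrix_vector_mult_scaleR flip: matrix_vector_mul_assoc)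
  show ?thesis
    by (simp add: expand inner_sum_left inner_sum_right
        mat_power_self_adjoint[OF assms(3) symmetric_shifted[OF assms(1,2)]])
qed


section \<open>Angles between a vector and a subspace\<close>

lemma normalized_inner_bounds: "-1 \<le> u \<bullet> w / (norm u * norm w)" "u \<bullet> w / (norm u * norm w) \<le> 1"
proof -
  have "\<bar>u \<bullet> w / (norm u * norm w)\<bar> \<le> 1"
    using Cauchy_Schwarz_ineq2[of u w] by (simp add: divide_le_eq abs_mult)
  then show "-1 \<le> u \<bullet> w / (norm u * norm w)" "u \<bullet> w / (norm u * norm w) \<le> 1" by linarith+
qed

lemma vec_angle_bounds: "0 \<le> vec_angle u w" "vec_angle u w \<le> pi"
  unfolding vec_angle_def
  by (auto intro!: arccos_lbound arccos_ubound normalized_inner_bounds)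

lemma cos_vec_angle: "cos (vec_angle u w) = u \<bullet> w / (norm u * norm w)"
  unfolding vec_angle_def by (intro cos_arccos normalized_inner_bounds)

lemma subspace_angle_le: "w \<in> W \<Longrightarrow> w \<noteq> 0 \<Longrightarrow> subspace_angle u W \<le> vec_angle u w"
  unfolding subspace_angle_def
  by (rule cInf_lower) (auto intro!: bdd_belowI[of _ 0] vec_angle_bounds)

lemma subspace_angle_nonneg: "w \<in> W \<Longrightarrow> w \<noteq> 0 \<Longrightarrow> 0 \<le> subspace_angle u W"
  unfolding subspace_angle_def by (rule cInf_greatest) (auto intro: vec_angle_bounds)

text \<open>A subspace contains with every vector its negative, so a lower bound on the angle bounds the
  inner product from both sides.\<close>

lemma inner_le_cos_lower_angle:
  assumes "subspace W" and "0 \<le> \<delta>" and "\<delta> \<le> subspace_angle u W" and "w \<in> W" and "w \<noteq> 0"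
  shows "\<bar>u \<bullet> w\<bar> \<le> cos \<delta> * (norm u * norm w)"
proof -
  have *: "u \<bullet> z \<le> cos \<delta> * (norm u * norm z)" if z: "z \<in> W" "z \<noteq> 0" for z
  proof (cases "u = 0")
    case False
    have "cos (vec_angle u z) \<le> cos \<delta>"
      using assms subspace_angle_le[OF z, of u] vec_angle_bounds[of u z] 
      by (intro cos_monotone_0_pi_le) auto
    then show ?thesis
      using False z by (simp add: cos_vec_angle divide_le_eq)
  qed simp
  show ?thesis using *[of w] *[of "- w"] assms subspace_neg[OF assms(1), of w] by auto
qed

lemma inner_le_cos_subspace_angle:
  assumes "subspace W" and "w \<in> W" 
  shows "\<bar>u \<bullet> w\<bar> \<le> \<bar>cos (subspace_angle u W)\<bar> * (norm u * norm w)"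
proof (cases "w = 0")
  case False
  have "\<bar>u \<bullet> w\<bar> \<le> cos (subspace_angle u W) * (norm u * norm w)"
    using assms False by (intro inner_le_cos_lower_angle subspace_angle_nonneg) auto
  also have "\<dots> \<le> \<bar>cos (subspace_angle u W)\<bar> * (norm u * norm w)"
    by (intro mult_right_mono) auto
  finally show ?thesis .
qed simp

text \<open>The constant is \<open>1 / sin \<delta>\<close>: subtracting from \<open>w\<close> its component along \<open>u\<close> loses at most
  that factor.\<close>

lemma norm_le_norm_add_off_subspace:
  assumes "subspace W" and \<delta>: "0 < \<delta>" "\<delta> < pi" and "\<delta> \<le> subspace_angle u W" and "w \<in> W"
  shows "norm w \<le> (1 / sin \<delta>) * norm (a *\<^sub>R u + w)"
proof (cases "w = 0")
  case True
  then show ?thesis using \<delta> sin_gt_zero[of \<delta>] by simp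
next
  case False
  have sin: "sin \<delta> > 0" using \<delta> by (intro sin_gt_zero)
  have "\<bar>u \<bullet> w\<bar> \<le> cos \<delta> * (norm u * norm w)"
    using assms False by (intro inner_le_cos_lower_angle[of W]) auto
  then have "\<bar>a\<bar> * \<bar>u \<bullet> w\<bar> \<le> \<bar>a\<bar> * (cos \<delta> * (norm u * norm w))" by (intro mult_left_mono) auto
  then have ip: "- 2 * a * (u \<bullet> w) \<le> 2 * (\<bar>a\<bar> * norm u) * (cos \<delta> * norm w)"
    using abs_ge_minus_self[of "a * (u \<bullet> w)"] by (simp add: abs_mult mult_ac)
  have "(norm (a *\<^sub>R u + w))\<^sup>2 = (\<bar>a\<bar> * norm u)\<^sup>2 + 2 * a * (u \<bullet> w) + (norm w)\<^sup>2"
    unfolding power_mult_distrib power2_norm_eq_inner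
    by (simp add: inner_add_left inner_add_right inner_commute power2_eq_square algebra_simps)
  also have "\<dots> \<ge> (\<bar>a\<bar> * norm u)\<^sup>2 - 2 * (\<bar>a\<bar> * norm u) * (cos \<delta> * norm w) + (norm w)\<^sup>2"
    using ip by simp
  also have "(\<bar>a\<bar> * norm u)\<^sup>2 - 2 * (\<bar>a\<bar> * norm u) * (cos \<delta> * norm w) + (norm w)\<^sup>2
      = (\<bar>a\<bar> * norm u - cos \<delta> * norm w)\<^sup>2 + (sin \<delta> * norm w)\<^sup>2"
    by (simp add: power2_diff power_mult_distrib sin_squared_eq algebra_simps)
  finally have "(sin \<delta> * norm w)\<^sup>2 \<le> (norm (a *\<^sub>R u + w))\<^sup>2" 
    using zero_le_power2[of "\<bar>a\<bar> * norm u - cos \<delta> * norm w"] by linarith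
  then have "sin \<delta> * norm w \<le> norm (a *\<^sub>R u + w)" by (rule power2_le_imp_le) simp
  then show ?thesis using sin by (simp add: field_simps)
qed

section \<open>The spectral gap of a symmetric definite pencil\<close>

locale definite_pencil =
  fixes A B :: "real^'n^'n" and ev :: "nat \<Rightarrow> real" and v :: "nat \<Rightarrow> real^'n"
  assumes symmetric_A: "transpose A = A"
    and spd_B: "spd B"
    and eigensystem: "pencil_eigensystem A B ev v"
    and dimension: "CARD('n) \<ge> 2"
    and gap: "ev 1 < ev 2"
    and ev_mono: "\<forall>i j. 2 \<le> i \<and> i \<le> j \<and> j \<le> CARD('n) \<longrightarrow> ev i \<le> ev j"
begin

lemma symmetric_B: "transpose B = B"
  using spd_B by (simp add: spd_def)

lemma A_inner: "(A *v x) \<bullet> y = x \<bullet> (A *v y)"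
  by (rule symmetric_inner[OF symmetric_A])

lemma B_inner: "(B *v x) \<bullet> y = x \<bullet> (B *v y)"
  by (rule symmetric_inner[OF symmetric_B])

lemma shifted_inner: "(shifted A B u *v x) \<bullet> y = x \<bullet> (shifted A B u *v y)"
  by (rule symmetric_inner[OF symmetric_shifted[OF symmetric_A symmetric_B]])

lemma eigenvector: "i \<in> {1..CARD('n)} \<Longrightarrow> A *v v i = ev i *\<^sub>R (B *v v i)"
  using eigensystem by (simp add: pencil_eigensystem_def)

lemma orthonormal:
  "i \<in> {1..CARD('n)} \<Longrightarrow> j \<in> {1..CARD('n)} \<Longrightarrow> v i \<bullet> (B *v v j) = (if i = j then 1 else 0)"
  using eigensystem by (simp add: pencil_eigensystem_def inner_in_def)

lemma eigenvector_expansion: "x = (\<Sum>i=1..CARD('n). (v i \<bullet> (B *v x)) *\<^sub>R v i)"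
proof -
  let ?I = "{1..CARD('n)}"
  have inj: "inj_on v ?I"
  proof (rule inj_onI)
    fix i j assume ij: "i \<in> ?I" "j \<in> ?I" "v i = v j"
    then show "i = j" using orthonormal[OF ij(1,1)] orthonormal[OF ij(1,2)] by (auto split: if_splits)
  qed
  have coeff: "v j \<bullet> (B *v (\<Sum>i\<in>?I. c i *\<^sub>R v i)) = c j" if "j \<in> ?I" for c j
    using that
    by (simp add: linear_sum[OF matrix_vector_mul_linear] inner_sum_right
        matrix_vector_mult_scaleR orthonormal if_distrib cong: if_cong)
  have "independent (v ` ?I)"
  proof (rule independent_if_scalars_zero)
    fix f x assume sum0: "(\<Sum>x\<in>v ` ?I. f x *\<^sub>R x) = 0" and "x \<in> v ` ?I"
    then obtain j where j: "j \<in> ?I" "x = v j" by auto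
    have "(\<Sum>i\<in>?I. f (v i) *\<^sub>R v i) = 0"
      using sum0 unfolding sum.reindex[OF inj] by (simp only: o_def)
    then show "f x = 0" using coeff[OF j(1), of "\<lambda>i. f (v i)"] j(2) by simp
  qed simp
  then have "UNIV \<subseteq> span (v ` ?I)"
    using card_image[OF inj] by (intro card_ge_dim_independent) simp_all
  then have "x \<in> span (v ` ?I)" by blast
  then obtain u where "x = (\<Sum>z\<in>v ` ?I. u z *\<^sub>R z)"
    unfolding span_finite[OF finite_imageI[OF finite_atLeastAtMost]] by auto
  then have u: "x = (\<Sum>i\<in>?I. u (v i) *\<^sub>R v i)"
    unfolding sum.reindex[OF inj] by (simp only: o_def)
  have "u (v i) = v i \<bullet> (B *v x)" if "i \<in> ?I" for i
    using coeff[OF that, of "\<lambda>i. u (v i)"] u by simp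
  then have "(\<Sum>i\<in>?I. u (v i) *\<^sub>R v i) = (\<Sum>i\<in>?I. (v i \<bullet> (B *v x)) *\<^sub>R v i)"
    by (intro sum.cong) auto
  then show ?thesis using u by metis
qed

lemma B_form_expansion: "x \<bullet> (B *v x) = (\<Sum>i=1..CARD('n). (v i \<bullet> (B *v x))\<^sup>2)"
  by (subst (1) eigenvector_expansion[of x]) (simp add: inner_sum_left power2_eq_square)

lemma A_form_expansion: "x \<bullet> (A *v x) = (\<Sum>i=1..CARD('n). ev i * (v i \<bullet> (B *v x))\<^sup>2)"
proof -
  have "x \<bullet> (A *v x) = (\<Sum>i=1..CARD('n). (v i \<bullet> (B *v x)) * (v i \<bullet> (A *v x)))"
    by (subst (1) eigenvector_expansion[of x]) (simp add: inner_sum_left)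
  also have "\<dots> = (\<Sum>i=1..CARD('n). ev i * (v i \<bullet> (B *v x))\<^sup>2)"
    by (intro sum.cong) (simp_all add: eigenvector B_inner power2_eq_square flip: A_inner)
  finally show ?thesis .
qed

text \<open>For a \<open>B\<close>-normalized \<open>x\<close> at \<open>B\<close>-angle \<open>\<theta>\<close> from the first eigenvector, the factor
  \<open>x\<^sup>T B x - (v\<^sub>1\<^sup>T B x)\<^sup>2\<close> is \<open>sin\<^sup>2 \<theta>\<close>.\<close>

lemma spectral_gap:
  defines "S \<equiv> \<lambda>x. x \<bullet> (B *v x) - (v 1 \<bullet> (B *v x))\<^sup>2"
  shows "(ev 2 - ev 1) * S x \<le> x \<bullet> (A *v x) - ev 1 * (x \<bullet> (B *v x))"
    and "x \<bullet> (A *v x) - ev 1 * (x \<bullet> (B *v x)) \<le> (ev CARD('n) - ev 1) * S x"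
proof -
  let ?c = "\<lambda>i. (v i \<bullet> (B *v x))\<^sup>2"
  have split_first: "(\<Sum>i=1..CARD('n). d i) = d 1 + (\<Sum>i=2..CARD('n). d i)" for d :: "nat \<Rightarrow> real"
    using dimension sum.atLeast_Suc_atMost[of 1 "CARD('n)" d] by (simp add: numeral_2_eq_2)
  have S: "S x = (\<Sum>i=2..CARD('n). ?c i)"
    unfolding S_def B_form_expansion[of x] split_first by simp
  have "x \<bullet> (A *v x) - ev 1 * (x \<bullet> (B *v x)) = (\<Sum>i=1..CARD('n). (ev i - ev 1) * ?c i)"
    unfolding A_form_expansion B_form_expansion
    by (simp add: sum_distrib_left sum_subtractf left_diff_distrib)
  also have "\<dots> = (\<Sum>i=2..CARD('n). (ev i - ev 1) * ?c i)"
    unfolding split_first by simp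
  finally have D: "x \<bullet> (A *v x) - ev 1 * (x \<bullet> (B *v x)) = (\<Sum>i=2..CARD('n). (ev i - ev 1) * ?c i)" .
  show "(ev 2 - ev 1) * S x \<le> x \<bullet> (A *v x) - ev 1 * (x \<bullet> (B *v x))"
    unfolding D S sum_distrib_left using ev_mono by (intro sum_mono mult_right_mono) auto
  show "x \<bullet> (A *v x) - ev 1 * (x \<bullet> (B *v x)) \<le> (ev CARD('n) - ev 1) * S x"
    unfolding D S sum_distrib_left using ev_mono by (intro sum_mono mult_right_mono) auto
qed

lemma ev_1_less_top: "ev 1 < ev CARD('n)"
  using gap ev_mono dimension by (meson le_refl less_le_trans)

lemma v1_normalized: "v 1 \<bullet> (B *v v 1) = 1"
  using orthonormal[of 1 1] dimension by simp

lemma v1_nonzero: "v 1 \<noteq> 0"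
  using v1_normalized by auto

lemma A_v1: "A *v v 1 = ev 1 *\<^sub>R (B *v v 1)"
  using eigenvector[of 1] dimension by simp

lemma off_v1_B_form:
  "(x - (v 1 \<bullet> (B *v x)) *\<^sub>R v 1) \<bullet> (B *v (x - (v 1 \<bullet> (B *v x)) *\<^sub>R v 1))
     = x \<bullet> (B *v x) - (v 1 \<bullet> (B *v x))\<^sup>2"
proof -
  have "x \<bullet> (B *v v 1) = v 1 \<bullet> (B *v x)" using B_inner[of x "v 1"] by (simp add: inner_commute)
  then show ?thesis
    using v1_normalized
    by (simp add: matrix_vector_mult_diff_distrib matrix_vector_mult_scaleR inner_diff_left
        inner_diff_right power2_eq_square algebra_simps)
qed

lemma cauchy_schwarz_B_v1: "(v 1 \<bullet> (B *v x))\<^sup>2 \<le> x \<bullet> (B *v x)"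
  using off_v1_B_form[of x] norm_in_sq[OF spd_B, of "x - (v 1 \<bullet> (B *v x)) *\<^sub>R v 1"]
    zero_le_power2[of "norm_in B (x - (v 1 \<bullet> (B *v x)) *\<^sub>R v 1)"] by linarith

text \<open>The angle between \<open>x\<close> and the first eigenvector: its cosine is the coefficient of \<open>v\<^sub>1\<close>.\<close>

lemma cos_angle_v1:
  assumes "norm_in B x = 1"
  shows "cos (angle_in B (v 1) x) = v 1 \<bullet> (B *v x)"
    and "(sin (angle_in B (v 1) x))\<^sup>2 = x \<bullet> (B *v x) - (v 1 \<bullet> (B *v x))\<^sup>2"
    and "0 \<le> sin (angle_in B (v 1) x)"
proof -
  have B1: "x \<bullet> (B *v x) = 1" using norm_in_sq[OF spd_B, of x] assms by simp
  have "norm_in B (v 1) = 1" using v1_normalized by (simp add: norm_in_def inner_in_def)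
  then have ang: "angle_in B (v 1) x = arccos (v 1 \<bullet> (B *v x))"
    using assms by (simp add: angle_in_def inner_in_def)
  have "\<bar>v 1 \<bullet> (B *v x)\<bar> \<le> 1" using cauchy_schwarz_B_v1[of x] B1 by (simp add: abs_square_le_1)
  then have bd: "-1 \<le> v 1 \<bullet> (B *v x)" "v 1 \<bullet> (B *v x) \<le> 1" by linarith+
  show c: "cos (angle_in B (v 1) x) = v 1 \<bullet> (B *v x)" unfolding ang using bd by (rule cos_arccos)
  show "(sin (angle_in B (v 1) x))\<^sup>2 = x \<bullet> (B *v x) - (v 1 \<bullet> (B *v x))\<^sup>2"
    using c B1 by (simp add: sin_squared_eq)
  show "0 \<le> sin (angle_in B (v 1) x)"
    unfolding ang using bd by (intro sin_ge_zero arccos_lbound arccos_ubound)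
qed

lemma rayleigh_ge_ev1: "x \<noteq> 0 \<Longrightarrow> ev 1 \<le> rayleigh A B x"
proof -
  assume "x \<noteq> 0"
  have "0 \<le> (ev 2 - ev 1) * (x \<bullet> (B *v x) - (v 1 \<bullet> (B *v x))\<^sup>2)"
    using gap cauchy_schwarz_B_v1[of x] by (intro mult_nonneg_nonneg) auto
  then have "ev 1 * (x \<bullet> (B *v x)) \<le> x \<bullet> (A *v x)" using spectral_gap(1)[of x] by linarith
  then show ?thesis
    using spd_inner_pos[OF spd_B \<open>x \<noteq> 0\<close>] by (simp add: rayleigh_def pos_le_divide_eq)
qed

lemma rayleigh_ge_ev2:
  assumes "x \<noteq> 0" and "x \<bullet> (B *v v 1) = 0"
  shows "ev 2 \<le> rayleigh A B x"
proof -
  have "v 1 \<bullet> (B *v x) = 0" using assms(2) B_inner[of x "v 1"] by (simp add: inner_commute)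
  then have "ev 2 * (x \<bullet> (B *v x)) \<le> x \<bullet> (A *v x)"
    using spectral_gap(1)[of x] by (simp add: algebra_simps)
  then show ?thesis
    using spd_inner_pos[OF spd_B assms(1)] by (simp add: rayleigh_def pos_le_divide_eq)
qed

lemma shifted_form_split:
  "x \<bullet> (shifted A B u *v x)
     = x \<bullet> (A *v x) - ev 1 * (x \<bullet> (B *v x)) - (rayleigh A B u - ev 1) * (x \<bullet> (B *v x))"
  by (simp add: shifted_mult inner_diff_right algebra_simps)


section \<open>Ritz vectors\<close>

text \<open>A minimizer over a subspace exists by compactness of its unit sphere; the form
  \<open>u\<^sup>T (A - \<mu> B) u\<close> is then nonnegative on the subspace and vanishes at the minimizer, which
  forces stationarity.\<close>

lemma rayleigh_minimizer_exists:
  assumes "subspace S" and "x \<in> S" and "x \<noteq> 0"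
  obtains z where "rayleigh_minimizer A B S z"
    and "\<And>u. u \<in> S \<Longrightarrow> u \<bullet> (A *v z) = rayleigh A B z * (u \<bullet> (B *v z))"
proof -
  let ?K = "S \<inter> sphere 0 1"
  have ne: "?K \<noteq> {}"
    using assms subspace_scale[OF assms(1,2), of "inverse (norm x)"]
    by (auto simp: disjoint_iff intro!: bexI[of _ "x /\<^sub>R norm x"])
  have comp: "compact ?K"
    using closed_subspace[OF assms(1)] by (simp add: closed_Int_compact)
  have cont: "continuous_on ?K (rayleigh A B)"
    unfolding rayleigh_def
  proof (intro continuous_intros linear_continuous_on matrix_vector_mul_bounded_linear ballI)
    fix u assume "u \<in> ?K"
    then have "u \<noteq> 0" by auto
    then show "u \<bullet> (B *v u) \<noteq> 0" using spd_inner_pos[OF spd_B, of u] by simp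
  qed
  obtain z where z: "z \<in> ?K" "\<And>u. u \<in> ?K \<Longrightarrow> rayleigh A B z \<le> rayleigh A B u"
    using continuous_attains_inf[OF comp ne cont] by blast
  have z0: "z \<noteq> 0" "z \<in> S" using z(1) by auto
  have min: "rayleigh A B z \<le> rayleigh A B u" if "u \<in> S" "u \<noteq> 0" for u
  proof -
    have "rayleigh A B z \<le> rayleigh A B (u /\<^sub>R norm u)"
      using that assms(1) by (intro z(2)) (auto simp: subspace_scale)
    then show ?thesis using that by (simp add: rayleigh_scaleR)
  qed
  define \<mu> where "\<mu> = rayleigh A B z"
  define q where "q u w = u \<bullet> (A *v w) - \<mu> * (u \<bullet> (B *v w))" for u w
  have q_nonneg: "0 \<le> q u u" if "u \<in> S" for u
  proof (cases "u = 0")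
    case False
    then show ?thesis using min[OF that False] spd_inner_pos[OF spd_B False]
      by (simp add: q_def \<mu>_def rayleigh_def[of _ _ u] pos_le_divide_eq)
  qed (simp add: q_def)
  have qz: "q z z = 0"
    using spd_inner_pos[OF spd_B z0(1)] by (simp add: q_def \<mu>_def rayleigh_def)
  have stationary: "q u z = 0" if u: "u \<in> S" for u
  proof -
    have expand: "q (z + t *\<^sub>R u) (z + t *\<^sub>R u) = 2 * t * q u z + t\<^sup>2 * q u u" for t
    proof -
      have "q z u = q u z"
        using A_inner[of z u] B_inner[of z u] by (simp add: q_def inner_commute)
      moreover have "q (z + t *\<^sub>R u) (z + t *\<^sub>R u) = q z z + t * q z u + t * q u z + t\<^sup>2 * q u u"
        by (simp add: q_def matrix_vector_right_distrib matrix_vector_mult_scaleR inner_add_left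
            inner_add_right power2_eq_square algebra_simps)
      ultimately show ?thesis using qz by simp
    qed
    have nonneg: "0 \<le> 2 * t * q u z + t\<^sup>2 * q u u" for t
      using q_nonneg[of "z + t *\<^sub>R u"] u z0 assms(1)
      by (simp add: expand subspace_add subspace_scale)
    define a where "a = q u u + 1"
    have a: "a > 0" using q_nonneg[OF u] by (simp add: a_def)
    have "0 \<le> 2 * (- q u z / a) * q u z + (- q u z / a)\<^sup>2 * (a - 1)"
      using nonneg[of "- q u z / a"] by (simp add: a_def)
    also have "\<dots> = - ((q u z)\<^sup>2 * (a + 1)) / a\<^sup>2"
      using a by (simp add: field_simps power2_eq_square)
    finally have "(q u z)\<^sup>2 * (a + 1) / a\<^sup>2 \<le> 0" by simp
    then show ?thesis using a by (simp add: divide_le_0_iff mult_le_0_iff)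
  qed
  show ?thesis
  proof (rule that)
    show "rayleigh_minimizer A B S z" using z0 min by (simp add: rayleigh_minimizer_def)
    show "u \<bullet> (A *v z) = rayleigh A B z * (u \<bullet> (B *v z))" if "u \<in> S" for u
      using stationary[OF that] by (simp add: q_def \<mu>_def)
  qed
qed

end

lemma lincomb_cols_in_span: "lincomb_cols Q w \<in> span (set Q)"
  unfolding lincomb_cols_def by (intro span_sum span_scale span_base) auto

lemma span_cols_cases:
  assumes "u \<in> span (set Q)"
  obtains w where "u = lincomb_cols Q w"
proof -
  have "subspace (range (lincomb_cols Q))"
  proof (rule subspaceI)
    show "0 \<in> range (lincomb_cols Q)"
      by (rule image_eqI[of _ _ "\<lambda>_. 0"]) (simp_all add: lincomb_cols_def)
    show "x + y \<in> range (lincomb_cols Q)"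
      if "x \<in> range (lincomb_cols Q)" "y \<in> range (lincomb_cols Q)" for x y
    proof -
      from that obtain a b where "x = lincomb_cols Q a" "y = lincomb_cols Q b" by auto
      then show ?thesis
        by (intro image_eqI[of _ _ "\<lambda>i. a i + b i"])
          (simp_all add: lincomb_cols_def sum.distrib scaleR_left_distrib)
    qed
    show "c *\<^sub>R x \<in> range (lincomb_cols Q)" if "x \<in> range (lincomb_cols Q)" for c x
    proof -
      from that obtain a where "x = lincomb_cols Q a" by auto
      then show ?thesis
        by (intro image_eqI[of _ _ "\<lambda>i. c * a i"]) (simp_all add: lincomb_cols_def scaleR_sum_right)
    qed
  qed
  moreover have "set Q \<subseteq> range (lincomb_cols Q)"
  proof
    fix x assume "x \<in> set Q"
    then obtain i where "i < length Q" "x = Q ! i" by (auto simp: in_set_conv_nth)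
    then show "x \<in> range (lincomb_cols Q)"
      by (intro image_eqI[of _ _ "\<lambda>j. if j = i then 1 else 0"])
        (simp_all add: lincomb_cols_def if_distrib[of "\<lambda>c. c *\<^sub>R _"] cong: if_cong)
  qed
  ultimately have "span (set Q) \<subseteq> range (lincomb_cols Q)" by (intro span_minimal)
  then show ?thesis using assms that by auto
qed

lemma projected_mult:
  "(\<Sum>j<length Q. projected A Q i j * w j) = (Q ! i) \<bullet> (A *v lincomb_cols Q w)"
  by (simp add: projected_def lincomb_cols_def linear_sum[OF matrix_vector_mul_linear]
      inner_sum_right matrix_vector_mult_scaleR mult.commute)

text \<open>The Galerkin form of the projected problem: the residual of the Ritz vector is orthogonal to the
  column space.\<close>

lemma gen_eigenpair_projected_iff:
  "gen_eigenpair (length Q) (projected A Q) (projected B Q) \<mu> w \<longleftrightarrow>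
     (\<exists>i<length Q. w i \<noteq> 0) \<and>
     (\<forall>u\<in>span (set Q). u \<bullet> (A *v lincomb_cols Q w) = \<mu> * (u \<bullet> (B *v lincomb_cols Q w)))"
proof -
  let ?z = "lincomb_cols Q w"
  have "(\<forall>i<length Q. (Q ! i) \<bullet> (A *v ?z) = \<mu> * ((Q ! i) \<bullet> (B *v ?z))) \<longleftrightarrow>
      (\<forall>u\<in>span (set Q). u \<bullet> (A *v ?z) = \<mu> * (u \<bullet> (B *v ?z)))" (is "?L \<longleftrightarrow> ?R")
  proof
    assume ?L
    then have "set Q \<subseteq> {u. u \<bullet> (A *v ?z) = \<mu> * (u \<bullet> (B *v ?z))}"
      by (auto simp: in_set_conv_nth)
    moreover have "subspace {u. u \<bullet> (A *v ?z) = \<mu> * (u \<bullet> (B *v ?z))}"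
      by (auto simp: subspace_def inner_add_left algebra_simps)
    ultimately show ?R using span_minimal by blast
  next
    assume ?R
    then show ?L by (simp add: span_base)
  qed
  then show ?thesis by (simp add: gen_eigenpair_def projected_mult)
qed

context definite_pencil
begin

text \<open>A minimizer of the Rayleigh quotient over the column space satisfies the Galerkin condition, so its
  value is among the projected eigenvalues and the lowest of these cannot exceed it.\<close>

lemma lowest_ritz_vector:
  assumes "lowest_eigenvector (length Q) (projected A Q) (projected B Q) w"
    and z: "lincomb_cols Q w \<noteq> 0"
  shows "u \<in> span (set Q) \<Longrightarrow> u \<bullet> residual A B (lincomb_cols Q w) = 0"
    and "u \<in> span (set Q) \<Longrightarrow> u \<noteq> 0 \<Longrightarrow> rayleigh A B (lincomb_cols Q w) \<le> rayleigh A B u"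
proof -
  let ?z = "lincomb_cols Q w"
  from assms(1) obtain \<mu> where
    pair: "gen_eigenpair (length Q) (projected A Q) (projected B Q) \<mu> w" and
    least: "\<And>\<nu> u. gen_eigenpair (length Q) (projected A Q) (projected B Q) \<nu> u \<Longrightarrow> \<mu> \<le> \<nu>"
    by (auto simp: lowest_eigenvector_def)
  have stat: "u \<bullet> (A *v ?z) = \<mu> * (u \<bullet> (B *v ?z))" if "u \<in> span (set Q)" for u
    using pair that by (simp add: gen_eigenpair_projected_iff)
  have \<mu>: "rayleigh A B ?z = \<mu>"
    using stat[OF lincomb_cols_in_span] spd_inner_pos[OF spd_B z] by (simp add: rayleigh_def)
  show "u \<in> span (set Q) \<Longrightarrow> u \<bullet> residual A B ?z = 0"
    by (simp add: residual_def shifted_mult inner_diff_right stat \<mu>)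
  show "rayleigh A B ?z \<le> rayleigh A B u" if u: "u \<in> span (set Q)" "u \<noteq> 0"
  proof -
    obtain y where y: "rayleigh_minimizer A B (span (set Q)) y"
      and stat_y: "\<And>u. u \<in> span (set Q) \<Longrightarrow> u \<bullet> (A *v y) = rayleigh A B y * (u \<bullet> (B *v y))"
      using rayleigh_minimizer_exists[OF subspace_span u] by blast
    have "y \<in> span (set Q)" "y \<noteq> 0" using y by (auto simp: rayleigh_minimizer_def)
    then obtain w' where w': "y = lincomb_cols Q w'" by (elim span_cols_cases)
    have "\<exists>i<length Q. w' i \<noteq> 0"
    proof (rule ccontr)
      assume "\<not> ?thesis"
      then have "lincomb_cols Q w' = 0" by (simp add: lincomb_cols_def)
      then show False using \<open>y \<noteq> 0\<close> w' by simp
    qed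
    then have "gen_eigenpair (length Q) (projected A Q) (projected B Q) (rayleigh A B y) w'"
      using stat_y by (simp add: gen_eigenpair_projected_iff w')
    then have "\<mu> \<le> rayleigh A B y" by (rule least)
    also have "\<dots> \<le> rayleigh A B u" using y u by (simp add: rayleigh_minimizer_def)
    finally show ?thesis by (simp add: \<mu>)
  qed
qed

end

section \<open>Orders of magnitude in a small parameter\<close>

locale small_parameter =
  fixes F :: "'i filter" and e :: "'i \<Rightarrow> real"
  assumes e_pos: "\<forall>\<^sub>F t in F. 0 < e t"
    and e_tendsto: "(e \<longlongrightarrow> 0) F"
begin

text \<open>The upper bound \<open>O(e\<^sup>n)\<close> and the lower bound \<open>\<Omega>(e\<^sup>n)\<close>, for values in any normed space.\<close>

definition vanishes :: "nat \<Rightarrow> ('i \<Rightarrow> 'b::real_normed_vector) \<Rightarrow> bool" where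
  "vanishes n f \<longleftrightarrow> (\<exists>C. \<forall>\<^sub>F t in F. norm (f t) \<le> C * e t ^ n)"

definition exceeds :: "nat \<Rightarrow> ('i \<Rightarrow> 'b::real_normed_vector) \<Rightarrow> bool" where
  "exceeds n f \<longleftrightarrow> (\<exists>c>0. \<forall>\<^sub>F t in F. c * e t ^ n \<le> norm (f t))"

lemma e_less: "0 < c \<Longrightarrow> \<forall>\<^sub>F t in F. e t < c"
  using e_tendsto by (rule order_tendstoD)

lemma vanishesE:
  assumes "vanishes n f"
  obtains C where "C > 0" "\<forall>\<^sub>F t in F. norm (f t) \<le> C * e t ^ n"
proof -
  from assms obtain C where C: "\<forall>\<^sub>F t in F. norm (f t) \<le> C * e t ^ n" by (auto simp: vanishes_def)
  show ?thesis
  proof (rule that)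
    show "\<forall>\<^sub>F t in F. norm (f t) \<le> (\<bar>C\<bar> + 1) * e t ^ n"
      using C e_pos
    proof eventually_elim
      case (elim t)
      have "C * e t ^ n \<le> (\<bar>C\<bar> + 1) * e t ^ n" using elim by (intro mult_right_mono) auto
      then show ?case using elim by linarith
    qed
  qed simp
qed

lemma vanishes_bound:
  assumes "vanishes n g" and "\<forall>\<^sub>F t in F. norm (f t) \<le> C * norm (g t)"
  shows "vanishes n f"
proof -
  obtain D where D: "D > 0" "\<forall>\<^sub>F t in F. norm (g t) \<le> D * e t ^ n" using assms(1) by (rule vanishesE)
  have "\<forall>\<^sub>F t in F. norm (f t) \<le> (\<bar>C\<bar> * D) * e t ^ n"
    using assms(2) D(2)
  proof eventually_elim
    case (elim t)
    have "C * norm (g t) \<le> \<bar>C\<bar> * norm (g t)" by (intro mult_right_mono) auto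
    also have "\<dots> \<le> \<bar>C\<bar> * (D * e t ^ n)" using elim by (intro mult_left_mono) auto
    finally show ?case using elim by (simp add: mult.assoc)
  qed
  then show ?thesis by (auto simp: vanishes_def)
qed

lemma vanishes_cong:
  assumes "vanishes n g" and "\<forall>\<^sub>F t in F. f t = g t"
  shows "vanishes n f"
  using assms(1) by (rule vanishes_bound[of _ _ _ 1]) (use assms(2) in \<open>auto elim: eventually_mono\<close>)

lemma vanishes_const: "vanishes 0 (\<lambda>_. c)"
  by (auto simp: vanishes_def intro!: exI[of _ "norm c"])

lemma vanishes_zero: "vanishes n (\<lambda>_. 0)"
  by (auto simp: vanishes_def intro!: exI[of _ 0])

lemma vanishes_parameter: "vanishes 1 e"
  using e_pos by (auto simp: vanishes_def intro!: exI[of _ 1] elim: eventually_mono)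

lemma vanishes_weaken:
  assumes "vanishes n f" and "m \<le> n"
  shows "vanishes m f"
proof -
  obtain C where C: "C > 0" "\<forall>\<^sub>F t in F. norm (f t) \<le> C * e t ^ n" using assms(1) by (rule vanishesE)
  have "\<forall>\<^sub>F t in F. norm (f t) \<le> C * e t ^ m"
    using C(2) e_pos e_less[OF zero_less_one]
  proof eventually_elim
    case (elim t)
    then have "e t ^ n \<le> e t ^ m" using assms(2) by (intro power_decreasing) auto
    then show ?case using elim C(1) by (meson order_trans mult_left_mono less_imp_le)
  qed
  then show ?thesis by (auto simp: vanishes_def)
qed

lemma vanishes_add:
  assumes "vanishes n f" and "vanishes n g"
  shows "vanishes n (\<lambda>t. f t + g t)"
proof -
  obtain C where C: "C > 0" "\<forall>\<^sub>F t in F. norm (f t) \<le> C * e t ^ n" using assms(1) by (rule vanishesE)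
  obtain D where D: "D > 0" "\<forall>\<^sub>F t in F. norm (g t) \<le> D * e t ^ n" using assms(2) by (rule vanishesE)
  have "\<forall>\<^sub>F t in F. norm (f t + g t) \<le> (C + D) * e t ^ n"
    using C(2) D(2)
  proof eventually_elim
    case (elim t)
    then show ?case using norm_triangle_ineq[of "f t" "g t"] by (simp add: distrib_right)
  qed
  then show ?thesis by (auto simp: vanishes_def)
qed

lemma vanishes_minus: "vanishes n f \<Longrightarrow> vanishes n (\<lambda>t. - f t)"
  by (simp add: vanishes_def)

lemma vanishes_diff: "vanishes n f \<Longrightarrow> vanishes n g \<Longrightarrow> vanishes n (\<lambda>t. f t - g t)"
  using vanishes_add[of n f "\<lambda>t. - g t"] vanishes_minus[of n g] by simp

lemma vanishes_sum:
  "(\<And>i. i \<in> I \<Longrightarrow> vanishes n (f i)) \<Longrightarrow> vanishes n (\<lambda>t. \<Sum>i\<in>I. f i t)"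
  by (induction I rule: infinite_finite_induct) (simp_all add: vanishes_zero vanishes_add)

lemma vanishes_bilinear:
  assumes "bounded_bilinear pr" and "vanishes m f" and "vanishes n g" and "k \<le> m + n"
  shows "vanishes k (\<lambda>t. pr (f t) (g t))"
proof -
  obtain K where K: "K > 0" "\<And>a b. norm (pr a b) \<le> norm a * norm b * K"
    using bounded_bilinear.pos_bounded[OF assms(1)] by blast
  obtain C where C: "C > 0" "\<forall>\<^sub>F t in F. norm (f t) \<le> C * e t ^ m" using assms(2) by (rule vanishesE)
  obtain D where D: "D > 0" "\<forall>\<^sub>F t in F. norm (g t) \<le> D * e t ^ n" using assms(3) by (rule vanishesE)
  have "\<forall>\<^sub>F t in F. norm (pr (f t) (g t)) \<le> (C * D * K) * e t ^ (m + n)"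
    using C(2) D(2) e_pos
  proof eventually_elim
    case (elim t)
    have "norm (f t) * norm (g t) * K \<le> (C * e t ^ m) * (D * e t ^ n) * K"
      using elim K(1) C(1) by (intro mult_right_mono mult_mono) auto
    then show ?case using K(2)[of "f t" "g t"] by (simp add: power_add mult_ac)
  qed
  then have "vanishes (m + n) (\<lambda>t. pr (f t) (g t))" by (auto simp: vanishes_def)
  then show ?thesis using assms(4) by (rule vanishes_weaken)
qed

lemmas vanishes_mult = vanishes_bilinear[OF bounded_bilinear_mult]
lemmas vanishes_scaleR = vanishes_bilinear[OF bounded_bilinear_scaleR]
lemmas vanishes_inner = vanishes_bilinear[OF bounded_bilinear_inner]
lemmas vanishes_matrix_vector = vanishes_bilinear[OF bounded_bilinear_matrix_vector]

lemma vanishes_const_matrix: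
  "vanishes n f \<Longrightarrow> vanishes n (\<lambda>t. (A :: real^'n^'m) *v f t)"
  by (rule vanishes_matrix_vector[OF vanishes_const]) auto

lemma vanishes_tendsto_0:
  assumes "vanishes (Suc n) f"
  shows "(f \<longlongrightarrow> 0) F"
proof -
  have "vanishes 1 f" using assms by (rule vanishes_weaken) simp
  then obtain C where C: "C > 0" "\<forall>\<^sub>F t in F. norm (f t) \<le> C * e t ^ 1" by (rule vanishesE)
  have "((\<lambda>t. C * e t ^ 1) \<longlongrightarrow> 0) F" using tendsto_mult_left[OF e_tendsto, of C] by simp
  then show ?thesis using C(2) by (rule Lim_null_comparison[rotated])
qed

lemma vanishes_norm: "vanishes n (\<lambda>t. norm (f t)) \<longleftrightarrow> vanishes n f"
  by (simp add: vanishes_def)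

lemma vanishes_power2_imp:
  fixes f :: "'i \<Rightarrow> real"
  assumes "vanishes 2 (\<lambda>t. (f t)\<^sup>2)"
  shows "vanishes 1 f"
proof -
  obtain C where C: "C > 0" "\<forall>\<^sub>F t in F. norm ((f t)\<^sup>2) \<le> C * (e t)\<^sup>2" using assms by (rule vanishesE)
  have "\<forall>\<^sub>F t in F. norm (f t) \<le> sqrt C * e t ^ 1"
    using C(2) e_pos
  proof eventually_elim
    case (elim t)
    have "\<bar>f t\<bar> \<le> sqrt C * e t"
      by (rule power2_le_imp_le) (use elim C(1) in \<open>simp_all add: power_mult_distrib\<close>)
    then show ?case by simp
  qed
  then show ?thesis unfolding vanishes_def by (rule exI)
qed

lemma exceedsI: "0 < c \<Longrightarrow> \<forall>\<^sub>F t in F. c * e t ^ n \<le> norm (f t) \<Longrightarrow> exceeds n f"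
  by (auto simp: exceeds_def)

lemma exceeds_bound:
  assumes "exceeds n g" and "0 < c" and "\<forall>\<^sub>F t in F. c * norm (g t) \<le> norm (f t)"
  shows "exceeds n f"
proof -
  obtain d where d: "d > 0" "\<forall>\<^sub>F t in F. d * e t ^ n \<le> norm (g t)"
    using assms(1) by (auto simp: exceeds_def)
  have "\<forall>\<^sub>F t in F. (c * d) * e t ^ n \<le> norm (f t)"
    using d(2) assms(3)
  proof eventually_elim
    case (elim t)
    have "c * (d * e t ^ n) \<le> c * norm (g t)" using elim assms(2) by (intro mult_left_mono) auto
    then show ?case using elim by (simp add: mult.assoc)
  qed
  then show ?thesis using assms(2) d(1) by (intro exceedsI[of "c * d"]) auto
qed

lemma exceeds_norm: "exceeds n (\<lambda>t. norm (f t)) \<longleftrightarrow> exceeds n f"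
  by (simp add: exceeds_def)

lemma exceeds_const: "c \<noteq> 0 \<Longrightarrow> exceeds 0 (\<lambda>_. c)"
  by (auto simp: exceeds_def intro!: exI[of _ "norm c"])

lemma exceeds_cong:
  assumes "exceeds n g" and "\<forall>\<^sub>F t in F. f t = g t"
  shows "exceeds n f"
  using assms(1) by (rule exceeds_bound[of _ _ 1]) (use assms(2) in \<open>auto elim: eventually_mono\<close>)

lemma exceeds_nonzero:
  assumes "exceeds n f"
  shows "\<forall>\<^sub>F t in F. f t \<noteq> 0"
proof -
  obtain c where c: "c > 0" "\<forall>\<^sub>F t in F. c * e t ^ n \<le> norm (f t)"
    using assms by (auto simp: exceeds_def)
  show ?thesis using c(2) e_pos
  proof eventually_elim
    case (elim t)
    have "0 < c * e t ^ n" using elim c(1) by simp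
    then show ?case using elim by auto
  qed
qed

lemma exceeds_add:
  assumes "exceeds n f" and "vanishes (Suc n) g"
  shows "exceeds n (\<lambda>t. f t + g t)"
proof -
  obtain c where c: "c > 0" "\<forall>\<^sub>F t in F. c * e t ^ n \<le> norm (f t)"
    using assms(1) by (auto simp: exceeds_def)
  obtain D where D: "D > 0" "\<forall>\<^sub>F t in F. norm (g t) \<le> D * e t ^ Suc n" using assms(2) by (rule vanishesE)
  have "0 < c / (2 * D)" using c(1) D(1) by simp
  then have "\<forall>\<^sub>F t in F. e t < c / (2 * D)" by (rule e_less)
  with c(2) D(2) e_pos have "\<forall>\<^sub>F t in F. (c / 2) * e t ^ n \<le> norm (f t + g t)"
  proof eventually_elim
    case (elim t)
    have "D * e t \<le> c / 2" using elim D(1) by (simp add: field_simps)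
    then have "D * e t * e t ^ n \<le> c / 2 * e t ^ n" using elim by (intro mult_right_mono) auto
    moreover have "D * e t ^ Suc n = D * e t * e t ^ n" by simp
    ultimately have "norm (g t) \<le> c / 2 * e t ^ n" using elim by linarith
    moreover have "norm (f t) - norm (g t) \<le> norm (f t + g t)"
      using norm_triangle_ineq2[of "f t" "- g t"] by simp
    moreover have "c * e t ^ n = c / 2 * e t ^ n + c / 2 * e t ^ n" by simp
    ultimately show ?case using elim by linarith
  qed
  then show ?thesis using c(1) by (intro exceedsI[of "c / 2"]) auto
qed

lemma exceeds_minus: "exceeds n f \<Longrightarrow> exceeds n (\<lambda>t. - f t)"
  by (simp add: exceeds_def)

lemma exceeds_diff: "exceeds n f \<Longrightarrow> vanishes (Suc n) g \<Longrightarrow> exceeds n (\<lambda>t. f t - g t)"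
  using exceeds_add[of n f "\<lambda>t. - g t"] vanishes_minus[of "Suc n" g] by simp

lemma exceeds_scaleR:
  assumes "exceeds m f" and "exceeds n g"
  shows "exceeds (m + n) (\<lambda>t. f t *\<^sub>R g t)"
proof -
  obtain c where c: "c > 0" "\<forall>\<^sub>F t in F. c * e t ^ m \<le> norm (f t)"
    using assms(1) by (auto simp: exceeds_def)
  obtain d where d: "d > 0" "\<forall>\<^sub>F t in F. d * e t ^ n \<le> norm (g t)"
    using assms(2) by (auto simp: exceeds_def)
  have "\<forall>\<^sub>F t in F. (c * d) * e t ^ (m + n) \<le> norm (f t *\<^sub>R g t)"
    using c(2) d(2) e_pos
  proof eventually_elim
    case (elim t)
    have "(c * e t ^ m) * (d * e t ^ n) \<le> norm (f t) * norm (g t)"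
      using elim c(1) d(1) by (intro mult_mono) auto
    then show ?case by (simp add: power_add mult_ac)
  qed
  then show ?thesis using c(1) d(1) by (intro exceedsI[of "c * d"]) auto
qed

lemma exceeds_mult:
  fixes f g :: "'i \<Rightarrow> real"
  shows "exceeds m f \<Longrightarrow> exceeds n g \<Longrightarrow> exceeds (m + n) (\<lambda>t. f t * g t)"
  using exceeds_scaleR[of m f n g] by simp

text \<open>Lower bounds on a vector are obtained from lower bounds on a product in which the other factor is
  known to be small.\<close>

lemma exceeds_cancel_bilinear:
  assumes "bounded_bilinear pr" and "exceeds (m + n) (\<lambda>t. pr (f t) (g t))" and "vanishes m f"
  shows "exceeds n g"
proof -
  obtain K where K: "K > 0" "\<And>a b. norm (pr a b) \<le> norm a * norm b * K"
    using bounded_bilinear.pos_bounded[OF assms(1)] by blast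
  obtain c where c: "c > 0" "\<forall>\<^sub>F t in F. c * e t ^ (m + n) \<le> norm (pr (f t) (g t))"
    using assms(2) by (auto simp: exceeds_def)
  obtain D where D: "D > 0" "\<forall>\<^sub>F t in F. norm (f t) \<le> D * e t ^ m" using assms(3) by (rule vanishesE)
  have "\<forall>\<^sub>F t in F. (c / (D * K)) * e t ^ n \<le> norm (g t)"
    using c(2) D(2) e_pos
  proof eventually_elim
    case (elim t)
    have "norm (f t) * (norm (g t) * K) \<le> D * e t ^ m * (norm (g t) * K)"
      using elim K(1) by (intro mult_right_mono) auto
    then have "c * e t ^ (m + n) \<le> D * e t ^ m * (norm (g t) * K)"
      using elim K(2)[of "f t" "g t"] by (simp add: mult.assoc)
    then have "e t ^ m * (c * e t ^ n) \<le> e t ^ m * (D * K * norm (g t))"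
      by (simp add: power_add mult_ac)
    then have "c * e t ^ n \<le> D * K * norm (g t)" using elim by simp
    then show ?case using D(1) K(1) by (simp add: field_simps)
  qed
  then show ?thesis using c(1) D(1) K(1) by (intro exceedsI[of "c / (D * K)"]) auto
qed

lemmas exceeds_cancel_inner = exceeds_cancel_bilinear[OF bounded_bilinear_inner]
lemmas exceeds_cancel_matrix_vector = exceeds_cancel_bilinear[OF bounded_bilinear_matrix_vector]

lemma vanishes_cancel:
  assumes "exceeds m a" and "vanishes (m + n) (\<lambda>t. a t *\<^sub>R f t)"
  shows "vanishes n f"
proof -
  obtain c where c: "c > 0" "\<forall>\<^sub>F t in F. c * e t ^ m \<le> norm (a t)"
    using assms(1) by (auto simp: exceeds_def)
  obtain D where D: "D > 0" "\<forall>\<^sub>F t in F. norm (a t *\<^sub>R f t) \<le> D * e t ^ (m + n)"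
    using assms(2) by (rule vanishesE)
  have "\<forall>\<^sub>F t in F. norm (f t) \<le> (D / c) * e t ^ n"
    using c(2) D(2) e_pos
  proof eventually_elim
    case (elim t)
    have "c * e t ^ m * norm (f t) \<le> norm (a t) * norm (f t)" using elim by (intro mult_right_mono) auto
    also have "norm (a t) * norm (f t) \<le> D * e t ^ (m + n)" using elim by simp
    finally have "e t ^ m * (c * norm (f t)) \<le> e t ^ m * (D * e t ^ n)"
      by (simp add: power_add mult_ac)
    then have "c * norm (f t) \<le> D * e t ^ n"
      by (rule mult_left_le_imp_le) (use elim in simp)
    then show ?case using c(1) by (simp add: field_simps)
  qed
  then show ?thesis unfolding vanishes_def by (rule exI)
qed

lemma vanishes_divide:
  fixes f a :: "'i \<Rightarrow> real"
  assumes "exceeds m a" and "vanishes (m + n) f"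
  shows "vanishes n (\<lambda>t. f t / a t)"
proof (rule vanishes_cancel[OF assms(1)])
  show "vanishes (m + n) (\<lambda>t. a t *\<^sub>R (f t / a t))"
    using assms(2) by (rule vanishes_cong) (use exceeds_nonzero[OF assms(1)] in eventually_elim, simp)
qed

lemma vanishes_in_bigo:
  fixes f s :: "'i \<Rightarrow> real"
  assumes "vanishes n f" and "exceeds n s"
  shows "f \<in> O[F](s)"
proof -
  obtain C where C: "C > 0" "\<forall>\<^sub>F t in F. norm (f t) \<le> C * e t ^ n" using assms(1) by (rule vanishesE)
  obtain d where d: "d > 0" "\<forall>\<^sub>F t in F. d * e t ^ n \<le> norm (s t)"
    using assms(2) by (auto simp: exceeds_def)
  have "\<forall>\<^sub>F t in F. norm (f t) \<le> (C / d) * norm (s t)"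
    using C(2) d(2)
  proof eventually_elim
    case (elim t)
    have "C * e t ^ n * d \<le> C * norm (s t)" using elim C(1) by (simp add: mult_ac)
    then have "C * e t ^ n \<le> C / d * norm (s t)" using d(1) by (simp add: field_simps)
    then show ?case using elim by linarith
  qed
  then show ?thesis by (rule bigoI)
qed

lemma vanishes_from_bigo:
  fixes f s :: "'i \<Rightarrow> real"
  assumes "f \<in> O[F](s)" and "vanishes n s"
  shows "vanishes n f"
proof -
  obtain C where "\<forall>\<^sub>F t in F. norm (f t) \<le> C * norm (s t)"
    using assms(1) by (elim landau_o.bigE)
  then show ?thesis using assms(2) by (intro vanishes_bound[of n s f C]) auto
qed

lemma vanishes_from_bigo_norm:
  fixes s :: "'i \<Rightarrow> real"
  shows "(\<lambda>t. norm (f t)) \<in> O[F](s) \<Longrightarrow> vanishes n s \<Longrightarrow> vanishes n f"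
  using vanishes_from_bigo[of "\<lambda>t. norm (f t)" s n] by (simp add: vanishes_norm)

end

section \<open>One run of the algorithm\<close>

text \<open>The convention \<open>p\<^sub>-\<^sub>1 = 0\<close> gives all steps, the initial one included, the same shape.\<close>

definition prev_dir :: "('n::finite) run \<Rightarrow> nat \<Rightarrow> real^'n" where
  "prev_dir R j = (if j = 0 then 0 else dir R (j - 1))"

text \<open>This is \<open>g\<^sub>j\<close> plus a multiple of \<open>p\<^sub>j\<^sub>-\<^sub>1\<close>. Unlike \<open>g\<^sub>j\<close>, it is controlled directly by the distance
  between consecutive iterates.\<close>

definition update :: "('n::finite) run \<Rightarrow> nat \<Rightarrow> real^'n" where
  "update R j = ritz_vec R j - coef R j 0 *\<^sub>R iter R j"

lemma lincomb_cols_Cons: "lincomb_cols (x # Q) w = w 0 *\<^sub>R x + lincomb_cols Q (\<lambda>i. w (Suc i))"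
  by (simp add: lincomb_cols_def sum.lessThan_Suc_shift del: sum.lessThan_Suc)

lemma lincomb_cols_snoc: "lincomb_cols (Q @ [x]) w = lincomb_cols Q w + w (length Q) *\<^sub>R x"
  by (simp add: lincomb_cols_def nth_append)

lemma update_eq:
  obtains \<omega> where "update R j = gvec R j + \<omega> *\<^sub>R prev_dir R j"
proof (cases "j = 0")
  case True
  then show ?thesis
    by (intro that[of 0]) (simp add: update_def ritz_vec_def trial_cols_def gvec_def lincomb_cols_Cons)
next
  case False
  then show ?thesis
    by (intro that[of "coef R j (Suc (length (basis R j)))"])
      (simp add: update_def ritz_vec_def trial_cols_def gvec_def prev_dir_def lincomb_cols_Cons
        lincomb_cols_snoc)
qed

lemma subspace_Wspace: "subspace (Wspace R j)"
  by (simp add: Wspace_def)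

lemma gvec_in_Wspace: "i < j \<Longrightarrow> gvec R i \<in> Wspace R j"
  unfolding Wspace_def by (intro span_base) auto

lemma Wspace_mono: "i \<le> j \<Longrightarrow> Wspace R i \<subseteq> Wspace R j"
  unfolding Wspace_def by (intro span_mono) auto

lemma Uspace_eq_span: "Uspace R j = span (insert (iter R 0) (gvec R ` {..<j}))"
  unfolding Uspace_def Wspace_def using span_Un[of "{iter R 0}" "gvec R ` {..<j}"] by simp

lemma Uspace_mono: "i \<le> j \<Longrightarrow> Uspace R i \<subseteq> Uspace R j"
  unfolding Uspace_eq_span by (intro span_mono) auto

lemma Wspace_subset_Uspace: "Wspace R j \<subseteq> Uspace R j"
  unfolding Uspace_eq_span Wspace_def by (intro span_mono) auto

lemma residual_scaleR: "c \<noteq> 0 \<Longrightarrow> residual A B (c *\<^sub>R u) = c *\<^sub>R residual A B u"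
  by (simp add: residual_def shifted_def rayleigh_scaleR matrix_vector_mult_scaleR)

text \<open>Nonvanishing Ritz vectors are all that keeps the normalization of the iterates well defined;
  the search directions may degenerate to \<open>0\<close>.\<close>

locale lanczos_run = definite_pencil +
  fixes M :: "real^'n^'n" and m K :: nat and R :: "'n run"
  assumes m_pos: "m > 0"
    and algorithm: "lanczos_plus_one A B M m K R"
    and ritz_nonzero: "j < K \<Longrightarrow> ritz_vec R j \<noteq> 0"
begin

lemma step:
  assumes "j < K"
  shows "lowest_eigenvector (length (trial_cols R j))
          (projected A (trial_cols R j)) (projected B (trial_cols R j)) (coef R j)"
    and "iter R (Suc j) = (1 / norm_in B (ritz_vec R j)) *\<^sub>R ritz_vec R j"
    and "dir R j = (1 / norm_in B (dir_unnorm A B R j)) *\<^sub>R dir_unnorm A B R j"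
    and "span (set (basis R j)) =
          (\<lambda>u. M *v u) ` krylov m (shifted A B (iter R j) ** M) (residual A B (iter R j))"
  using algorithm assms by (auto simp: lanczos_plus_one_def)

lemma iter_normalized: "j \<le> K \<Longrightarrow> norm_in B (iter R j) = 1"
proof (cases j)
  case 0
  then show ?thesis using algorithm by (simp add: lanczos_plus_one_def)
next
  case (Suc i)
  assume "j \<le> K"
  then show ?thesis using Suc norm_in_normalize[OF spd_B ritz_nonzero[of i]] by (simp add: step(2))
qed

lemma iter_nonzero: "j \<le> K \<Longrightarrow> iter R j \<noteq> 0"
  using iter_normalized[of j] norm_in_eq_0_iff[OF spd_B, of "iter R j"] by auto

lemma rho_bounds:
  assumes "j \<le> K"
  shows "(ev 2 - ev 1) * (sin (theta B (v 1) R j))\<^sup>2 \<le> rho A B R j - ev 1"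
    and "rho A B R j - ev 1 \<le> (ev CARD('n) - ev 1) * (sin (theta B (v 1) R j))\<^sup>2"
proof -
  let ?x = "iter R j"
  have "?x \<bullet> (B *v ?x) = 1"
    using norm_in_sq[OF spd_B, of ?x] iter_normalized[OF assms] by simp
  then show "(ev 2 - ev 1) * (sin (theta B (v 1) R j))\<^sup>2 \<le> rho A B R j - ev 1"
    and "rho A B R j - ev 1 \<le> (ev CARD('n) - ev 1) * (sin (theta B (v 1) R j))\<^sup>2"
    using spectral_gap[of ?x] cos_angle_v1(2)[OF iter_normalized[OF assms]]
    by (simp_all add: rayleigh_def theta_def)
qed

lemma iter_Suc:
  assumes "j < K"
  shows "norm_in B (ritz_vec R j) *\<^sub>R iter R (Suc j) = coef R j 0 *\<^sub>R iter R j + update R j"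
  using ritz_nonzero[OF assms] norm_in_eq_0_iff[OF spd_B, of "ritz_vec R j"]
  by (simp add: step(2)[OF assms] update_def)

lemma dir_unnorm_eq: 
  assumes "j < K"
  shows "norm_in B (dir_unnorm A B R j) *\<^sub>R dir R j = dir_unnorm A B R j"
  using norm_in_eq_0_iff[OF spd_B, of "dir_unnorm A B R j"] by (simp add: step(3)[OF assms])

lemma norm_in_dir_le: "j < K \<Longrightarrow> norm_in B (dir R j) \<le> 1"
  using norm_in_nonneg[OF spd_B, of "dir_unnorm A B R j"]
  by (simp add: step(3) norm_in_scaleR[OF spd_B])

lemma norm_in_dir: "j < K \<Longrightarrow> dir_unnorm A B R j \<noteq> 0 \<Longrightarrow> norm_in B (dir R j) = 1"
  by (simp add: step(3) norm_in_normalize[OF spd_B])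

lemma dir_in_Wspace: "j < K \<Longrightarrow> dir R j \<in> Wspace R (Suc j)"
proof (induction j)
  case 0
  then show ?case
    by (simp add: step(3)[OF 0] dir_unnorm_def subspace_scale[OF subspace_Wspace] gvec_in_Wspace)
next
  case (Suc j)
  then have "dir R j \<in> Wspace R (Suc (Suc j))" using Wspace_mono[of "Suc j" "Suc (Suc j)" R] by auto
  then show ?case using Suc.prems
    by (simp add: step(3)[OF Suc.prems] dir_unnorm_def subspace_scale[OF subspace_Wspace]
        subspace_diff[OF subspace_Wspace] gvec_in_Wspace)
qed

lemma prev_dir_in_Wspace: "j \<le> K \<Longrightarrow> prev_dir R j \<in> Wspace R j"
  using dir_in_Wspace[of "j - 1"] by (cases j) (auto simp: prev_dir_def subspace_0[OF subspace_Wspace])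

lemma update_in_Wspace:
  assumes "j < K"
  shows "update R j \<in> Wspace R (Suc j)"
proof -
  obtain \<omega> where "update R j = gvec R j + \<omega> *\<^sub>R prev_dir R j" by (rule update_eq)
  moreover have "prev_dir R j \<in> Wspace R (Suc j)"
    using prev_dir_in_Wspace[of j] Wspace_mono[of j "Suc j" R] assms by auto
  ultimately show ?thesis
    by (simp add: subspace_add[OF subspace_Wspace] subspace_scale[OF subspace_Wspace] gvec_in_Wspace)
qed

lemma iter_in_Uspace: "j \<le> K \<Longrightarrow> iter R j \<in> Uspace R j"
proof (induction j)
  case 0
  show ?case unfolding Uspace_eq_span by (intro span_base) auto
next
  case (Suc j)
  have U: "subspace (Uspace R (Suc j))" by (simp add: Uspace_eq_span)
  have "iter R j \<in> Uspace R (Suc j)" using Suc Uspace_mono[of j "Suc j" R] by auto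
  moreover have "update R j \<in> Uspace R (Suc j)"
    using update_in_Wspace[of j] Wspace_subset_Uspace[of R "Suc j"] Suc.prems by auto
  ultimately have "norm_in B (ritz_vec R j) *\<^sub>R iter R (Suc j) \<in> Uspace R (Suc j)"
    using Suc.prems by (simp add: iter_Suc subspace_add[OF U] subspace_scale[OF U])
  then have "inverse (norm_in B (ritz_vec R j)) *\<^sub>R norm_in B (ritz_vec R j) *\<^sub>R iter R (Suc j)
      \<in> Uspace R (Suc j)"
    by (rule subspace_scale[OF U])
  then show ?case
    using ritz_nonzero[of j] norm_in_eq_0_iff[OF spd_B, of "ritz_vec R j"] Suc.prems by simp
qed


subsection \<open>The trial space\<close>

lemma iter_in_trial: "iter R j \<in> span (set (trial_cols R j))"
  by (rule span_base) (simp add: trial_cols_def)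

lemma basis_in_trial: "span (set (basis R j)) \<subseteq> span (set (trial_cols R j))"
  by (rule span_mono) (auto simp: trial_cols_def)

lemma gvec_in_trial: "gvec R j \<in> span (set (trial_cols R j))"
  using lincomb_cols_in_span[of "basis R j"] basis_in_trial[of j] by (auto simp: gvec_def)

lemma prev_dir_in_trial: "prev_dir R j \<in> span (set (trial_cols R j))"
  by (cases j) (auto simp: prev_dir_def trial_cols_def span_zero intro!: span_base)

lemma dir_in_trial:
  assumes "j < K"
  shows "dir R j \<in> span (set (trial_cols R j))"
proof -
  have "dir_unnorm A B R j \<in> span (set (trial_cols R j))"
    using gvec_in_trial[of j] prev_dir_in_trial[of j]
    by (cases j) (auto simp: dir_unnorm_def prev_dir_def intro!: span_scale span_diff)
  then show ?thesis by (simp add: step(3)[OF assms] span_scale)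
qed

lemma preconditioned_residual_in_trial:
  assumes "j < K"
  shows "M *v residual A B (iter R j) \<in> span (set (trial_cols R j))"
proof -
  let ?r = "residual A B (iter R j)" and ?C = "shifted A B (iter R j) ** M"
  have "mat_power ?C 0 *v ?r \<in> krylov m ?C ?r"
    unfolding krylov_def using m_pos by (intro span_base imageI) simp
  then have "?r \<in> krylov m ?C ?r" by (simp add: mat_power_def)
  then have "M *v ?r \<in> span (set (basis R j))" by (simp add: step(4)[OF assms])
  then show ?thesis using basis_in_trial[of j] by auto
qed

lemma
  assumes "j < K" and "u \<in> span (set (trial_cols R j))"
  shows residual_orthogonal_trial: "u \<bullet> residual A B (iter R (Suc j)) = 0"
    and iter_optimal_trial: "u \<noteq> 0 \<Longrightarrow> rho A B R (Suc j) \<le> rayleigh A B u"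
proof -
  have c: "1 / norm_in B (ritz_vec R j) \<noteq> 0"
    using ritz_nonzero[OF assms(1)] norm_in_eq_0_iff[OF spd_B, of "ritz_vec R j"] by simp
  have nz: "lincomb_cols (trial_cols R j) (coef R j) \<noteq> 0"
    using ritz_nonzero[OF assms(1)] by (simp add: ritz_vec_def)
  show "u \<bullet> residual A B (iter R (Suc j)) = 0"
    unfolding step(2)[OF assms(1)] residual_scaleR[OF c]
    using lowest_ritz_vector(1)[OF step(1)[OF assms(1)] nz assms(2)] by (simp add: ritz_vec_def)
  show "rho A B R (Suc j) \<le> rayleigh A B u" if "u \<noteq> 0"
    unfolding step(2)[OF assms(1)] rayleigh_scaleR[OF c]
    using lowest_ritz_vector(2)[OF step(1)[OF assms(1)] nz assms(2) that] by (simp add: ritz_vec_def)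
qed

lemma prev_dir_residual: "j \<le> K \<Longrightarrow> prev_dir R j \<bullet> residual A B (iter R j) = 0"
  using residual_orthogonal_trial[of "j - 1" "dir R (j - 1)"] dir_in_trial[of "j - 1"]
  by (cases j) (auto simp: prev_dir_def)

lemma prev_dir_residual_Suc: "j < K \<Longrightarrow> prev_dir R j \<bullet> residual A B (iter R (Suc j)) = 0"
  by (intro residual_orthogonal_trial prev_dir_in_trial)

lemma gvec_residual_Suc: "j < K \<Longrightarrow> gvec R j \<bullet> residual A B (iter R (Suc j)) = 0"
  by (intro residual_orthogonal_trial gvec_in_trial)

text \<open>The first search direction is the normalized \<open>g\<^sub>0\<close> itself, and it is a column of the trial
  matrix at step 1.\<close>

lemma gvec_0_in_trial_1:
  assumes "1 < K"
  shows "gvec R 0 \<in> span (set (trial_cols R 1))"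
proof -
  have "norm_in B (gvec R 0) *\<^sub>R prev_dir R 1 = gvec R 0"
    using dir_unnorm_eq[of 0] assms by (simp add: dir_unnorm_def prev_dir_def)
  moreover have "norm_in B (gvec R 0) *\<^sub>R prev_dir R 1 \<in> span (set (trial_cols R 1))"
    by (intro span_scale prev_dir_in_trial)
  ultimately show ?thesis by (simp only:)
qed

lemma gvec_0_residual_2: "1 < K \<Longrightarrow> gvec R 0 \<bullet> residual A B (iter R 2) = 0"
  using residual_orthogonal_trial[of 1 "gvec R 0"] gvec_0_in_trial_1 by (simp add: numeral_2_eq_2)

text \<open>Two steps are optimal over all of \<open>U\<^sub>2\<close>: the trial space at step 1 recovers \<open>x\<^sub>0\<close> from \<open>x\<^sub>1\<close>
  and \<open>p\<^sub>0\<close>, unless \<open>x\<^sub>0\<close> did not enter \<open>x\<^sub>1\<close> at all.\<close>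

lemma Uspace_2_subset_trial:
  assumes "1 < K" and "coef R 0 0 \<noteq> 0"
  shows "Uspace R 2 \<subseteq> span (set (trial_cols R 1))"
proof -
  let ?T = "span (set (trial_cols R 1))"
  have "update R 0 = gvec R 0"
  proof -
    obtain \<omega> where "update R 0 = gvec R 0 + \<omega> *\<^sub>R prev_dir R 0" by (rule update_eq)
    then show ?thesis by (simp add: prev_dir_def)
  qed
  then have "coef R 0 0 *\<^sub>R iter R 0 = norm_in B (ritz_vec R 0) *\<^sub>R iter R 1 - gvec R 0"
    using iter_Suc[of 0] assms(1) by simp
  moreover have "norm_in B (ritz_vec R 0) *\<^sub>R iter R 1 - gvec R 0 \<in> ?T"
    by (intro span_diff span_scale iter_in_trial gvec_0_in_trial_1 assms)
  ultimately have "coef R 0 0 *\<^sub>R iter R 0 \<in> ?T" by (simp only:)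
  then have "inverse (coef R 0 0) *\<^sub>R coef R 0 0 *\<^sub>R iter R 0 \<in> ?T" by (rule span_scale)
  then have "iter R 0 \<in> ?T" using assms(2) by simp
  then show ?thesis
    unfolding Uspace_eq_span using gvec_0_in_trial_1[OF assms(1)] gvec_in_trial[of 1]
    by (intro span_minimal) (auto simp: less_Suc_eq numeral_2_eq_2)
qed

lemma rho_2_le:
  assumes "1 < K" and "coef R 0 0 \<noteq> 0" and "u \<in> Uspace R 2" and "u \<noteq> 0"
  shows "rho A B R 2 \<le> rayleigh A B u"
  using iter_optimal_trial[of 1 u] Uspace_2_subset_trial assms by (auto simp: numeral_2_eq_2)

lemma conjugate_prev_dir:
  assumes "0 < j" and "j < K"
    and "dir R (j - 1) \<bullet> (shifted A B (iter R (j - 1)) *v dir R (j - 1)) \<noteq> 0"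
  shows "dir R (j - 1) \<bullet> (shifted A B (iter R (j - 1)) *v dir R j) = 0"
  using assms
  by (simp add: step(3)[OF assms(2)] dir_unnorm_def matrix_vector_mult_scaleR matrix_vector_mult_diff_distrib
      inner_diff_right)

text \<open>Subtracting a multiple of \<open>p\<^sub>j\<^sub>-\<^sub>1\<close> before projecting it out makes no difference; so \<open>g\<^sub>j\<close> can
  be replaced by the update.\<close>

lemma dir_unnorm_via_update:
  assumes "0 < j"
    and "dir R (j - 1) \<bullet> (shifted A B (iter R (j - 1)) *v dir R (j - 1)) \<noteq> 0"
  shows "dir_unnorm A B R j = update R j -
    (dir R (j - 1) \<bullet> (shifted A B (iter R (j - 1)) *v update R j) /
      (dir R (j - 1) \<bullet> (shifted A B (iter R (j - 1)) *v dir R (j - 1)))) *\<^sub>R dir R (j - 1)"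
proof -
  obtain \<omega> where "update R j = gvec R j + \<omega> *\<^sub>R prev_dir R j" by (rule update_eq)
  then show ?thesis using assms
    by (simp add: dir_unnorm_def prev_dir_def matrix_vector_right_distrib matrix_vector_mult_scaleR
        inner_add_right add_divide_distrib scaleR_left_distrib)
qed

end

section \<open>A family of runs with \<open>\<theta>\<^sub>0 \<longrightarrow> 0\<close>\<close>

locale lanczos_family = definite_pencil A B ev v
  for A B :: "real^'n^'n" and ev v +
  fixes M :: "real^'n^'n" and m K :: nat and F :: "'i filter" and R :: "'i \<Rightarrow> 'n run"
    and \<xi>l \<xi>u :: real
  assumes spd_M: "spd M"
    and m_positive: "m > 0"
    and theta0_tendsto: "filterlim (\<lambda>t. theta B (v 1) (R t) 0) (at_right 0) F"
    and algorithms: "\<forall>\<^sub>F t in F. lanczos_plus_one A B M m K (R t)"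
    and scaling: "scaling_convention F B R K"
    and linear: "linear_convergence F A B (ev 1) (ev 2) \<xi>l \<xi>u R K"
    and angle: "angle_assumption F (v 1) R K"
    and polynomial: "polynomial_assumption F A B M m (v 1) R K"
begin

definition eps :: "'i \<Rightarrow> real" where
  "eps t = sin (theta B (v 1) (R t) 0)"

text \<open>The letters of the algorithm. In addition \<open>s\<^sub>j x\<^sub>j\<^sub>+\<^sub>1 = a\<^sub>j x\<^sub>j + h\<^sub>j\<close> relates consecutive iterates,
  \<open>d\<^sub>j\<close> is the length lost in normalizing \<open>p\<^sub>j\<close>, and \<open>x\<^sub>j = c\<^sub>j v\<^sub>1 + f\<^sub>j\<close> splits off the eigenvector.\<close>

abbreviation "x j t \<equiv> iter (R t) j"
abbreviation "r j t \<equiv> residual A B (iter (R t) j)"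
abbreviation "N j t \<equiv> shifted A B (iter (R t) j)"
abbreviation "g j t \<equiv> gvec (R t) j"
abbreviation "h j t \<equiv> update (R t) j"
abbreviation "p j t \<equiv> dir (R t) j"
abbreviation "a j t \<equiv> coef (R t) j 0"
abbreviation "s j t \<equiv> norm_in B (ritz_vec (R t) j)"
abbreviation "d j t \<equiv> norm_in B (dir_unnorm A B (R t) j)"
abbreviation "\<theta> j t \<equiv> theta B (v 1) (R t) j"
abbreviation "c j t \<equiv> v 1 \<bullet> (B *v iter (R t) j)"
abbreviation "f j t \<equiv> iter (R t) j - (v 1 \<bullet> (B *v iter (R t) j)) *\<^sub>R v 1"

sublocale small_parameter F eps
proof
  have "\<forall>\<^sub>F t in F. \<theta> 0 t \<in> {0<..<pi}"
    by (rule eventually_compose_filterlim[OF eventually_at_right_real[OF pi_gt_zero] theta0_tendsto])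
  then show "\<forall>\<^sub>F t in F. 0 < eps t"
    by (rule eventually_mono) (auto simp: eps_def intro: sin_gt_zero)
  have "(\<theta> 0 \<longlongrightarrow> 0) F" using theta0_tendsto by (simp add: filterlim_at)
  then have "((\<lambda>t. sin (\<theta> 0 t)) \<longlongrightarrow> sin 0) F" by (rule isCont_tendsto_compose[OF isCont_sin])
  then show "(eps \<longlongrightarrow> 0) F" by (simp add: eps_def[abs_def])
qed

lemma vanishes_norm_in: "vanishes n (\<lambda>t. norm_in B (w t)) \<longleftrightarrow> vanishes n w"
proof -
  obtain b c where bc: "b > 0" "c > 0" "\<And>u. b * norm u \<le> norm_in B u" "\<And>u. norm_in B u \<le> c * norm u"
    by (rule norm_in_equivalent[OF spd_B]) (rule that)
  have 1: "norm u \<le> (1 / b) * norm (norm_in B u)" and 2: "norm (norm_in B u) \<le> c * norm u" for u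
    using bc(1) bc(3,4)[of u] norm_in_nonneg[OF spd_B, of u] by (simp_all add: field_simps)
  show ?thesis
    using vanishes_bound[OF _ always_eventually, of n "\<lambda>t. norm_in B (w t)" w] 1
      vanishes_bound[OF _ always_eventually, of n w "\<lambda>t. norm_in B (w t)"] 2
    by blast
qed

lemma exceeds_norm_in: "exceeds n (\<lambda>t. norm_in B (w t)) \<longleftrightarrow> exceeds n w"
proof -
  obtain b c where bc: "b > 0" "c > 0" "\<And>u. b * norm u \<le> norm_in B u" "\<And>u. norm_in B u \<le> c * norm u"
    by (rule norm_in_equivalent[OF spd_B]) (rule that)
  have 1: "b * norm u \<le> norm (norm_in B u)" and 2: "(1 / c) * norm (norm_in B u) \<le> norm u" for u
    using bc(1,2) bc(3,4)[of u] norm_in_nonneg[OF spd_B, of u] by (simp_all add: field_simps)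
  have "0 < 1 / c" using bc by simp
  then show ?thesis
    using exceeds_bound[OF _ _ always_eventually, of n "\<lambda>t. norm_in B (w t)" "1 / c" w] 2
      exceeds_bound[OF _ _ always_eventually, of n w b "\<lambda>t. norm_in B (w t)"] 1 bc(1)
    by blast
qed

lemma s_bounded: "j < K \<Longrightarrow> vanishes 0 (s j)"
  and s_exceeds: "j < K \<Longrightarrow> exceeds 0 (s j)"
proof -
  assume "j < K"
  then have \<Theta>: "s j \<in> \<Theta>[F](\<lambda>_. 1)" using scaling by (simp add: scaling_convention_def)
  obtain C where "\<forall>\<^sub>F t in F. norm (s j t) \<le> C * norm (1::real)"
    using bigthetaD1[OF \<Theta>] by (elim landau_o.bigE)
  then show "vanishes 0 (s j)" by (auto simp: vanishes_def)
  obtain C' where "C' > 0" "\<forall>\<^sub>F t in F. norm (s j t) \<ge> C' * norm (1::real)"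
    using bigthetaD2[OF \<Theta>] by (elim landau_omega.bigE)
  then show "exceeds 0 (s j)" by (intro exceedsI[of C']) auto
qed

text \<open>The scaling convention excludes vanishing Ritz vectors.\<close>

lemma runs: "\<forall>\<^sub>F t in F. lanczos_run A B ev v M m K (R t)"
proof -
  have "\<forall>\<^sub>F t in F. s j t \<noteq> 0" if "j < K" for j
    using s_exceeds[OF that] by (rule exceeds_nonzero)
  then have "\<forall>\<^sub>F t in F. \<forall>j\<in>{..<K}. s j t \<noteq> 0" by (intro eventually_ball_finite) auto
  with algorithms show ?thesis
  proof eventually_elim
    case (elim t)
    show ?case
    proof (intro lanczos_run.intro definite_pencil_axioms lanczos_run_axioms.intro)
      show "ritz_vec (R t) j \<noteq> 0" if "j < K" for j
        using elim(2) that norm_in_eq_0_iff[OF spd_B, of "ritz_vec (R t) j"] by auto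
    qed (use m_positive elim in auto)
  qed
qed

lemmas run_fact = eventually_mono[OF runs]


subsection \<open>Eigenvalue error, angle and residual\<close>

text \<open>For small \<open>\<theta>\<^sub>0\<close> the initial Rayleigh quotient lies strictly between \<open>\<lambda>\<^sub>1\<close> and \<open>\<lambda>\<^sub>2\<close>, where the
  linear convergence assumption applies.\<close>

lemma rho_convergence:
  assumes "j \<le> K"
  shows "\<forall>\<^sub>F t in F. \<xi>l ^ j * (rho A B (R t) 0 - ev 1) \<le> rho A B (R t) j - ev 1 \<and>
    rho A B (R t) j - ev 1 \<le> \<xi>u ^ j * (rho A B (R t) 0 - ev 1)"
proof -
  let ?D = "ev CARD('n) - ev 1"
  have D: "?D > 0" using ev_1_less_top by simp
  have lin: "\<forall>\<^sub>F t in F. rho A B (R t) 0 \<in> {ev 1<..<ev 2} \<longrightarrow>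
        (\<forall>k\<le>K. \<forall>j<k.
           \<xi>l ^ (k - j) * (rho A B (R t) j - ev 1) \<le> rho A B (R t) k - ev 1 \<and>
           rho A B (R t) k - ev 1 \<le> \<xi>u ^ (k - j) * (rho A B (R t) j - ev 1))"
    using linear by (simp add: linear_convergence_def)
  have "0 < (ev 2 - ev 1) / ?D" using D gap by simp
  then have small: "\<forall>\<^sub>F t in F. eps t < (ev 2 - ev 1) / ?D" by (rule e_less)
  show ?thesis
    using lin runs e_pos small e_less[OF zero_less_one]
  proof eventually_elim
    case (elim t)
    interpret lanczos_run A B ev v M m K "R t" by fact
    have "0 < (ev 2 - ev 1) * (eps t)\<^sup>2" using gap elim by simp
    then have 1: "ev 1 < rho A B (R t) 0" using rho_bounds(1)[of 0] by (simp add: eps_def)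
    have "(eps t)\<^sup>2 \<le> eps t" using elim by (simp add: power2_eq_square mult_left_le)
    then have "(eps t)\<^sup>2 < (ev 2 - ev 1) / ?D" using elim by linarith
    then have "?D * (eps t)\<^sup>2 < ev 2 - ev 1" using D by (simp add: pos_less_divide_eq mult.commute)
    then have 2: "rho A B (R t) 0 < ev 2" using rho_bounds(2)[of 0] by (simp add: eps_def)
    show ?case
    proof (cases "j = 0")
      case False
      moreover have "rho A B (R t) 0 \<in> {ev 1<..<ev 2}" using 1 2 by simp
      ultimately show ?thesis using elim(1)[rule_format, OF _ assms, of 0] by simp
    qed simp
  qed
qed

lemma \<xi>l_pos: "0 < \<xi>l" and \<xi>u_pos: "0 < \<xi>u"
  using linear by (auto simp: linear_convergence_def)

text \<open>This lower bound and the matching upper bound give all the finitely many steps a common small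
  parameter: \<open>O(sin \<theta>\<^sub>j)\<close> and \<open>O(sin \<theta>\<^sub>0)\<close> mean the same.\<close>

lemma rho_exceeds:
  assumes "j \<le> K"
  shows "exceeds 2 (\<lambda>t. rho A B (R t) j - ev 1)"
proof (rule exceedsI)
  show "0 < \<xi>l ^ j * (ev 2 - ev 1)" using \<xi>l_pos gap by simp
  show "\<forall>\<^sub>F t in F. \<xi>l ^ j * (ev 2 - ev 1) * (eps t)\<^sup>2 \<le> norm (rho A B (R t) j - ev 1)"
    using rho_convergence[OF assms] runs
  proof eventually_elim
    case (elim t)
    interpret lanczos_run A B ev v M m K "R t" by fact
    have "\<xi>l ^ j * ((ev 2 - ev 1) * (eps t)\<^sup>2) \<le> \<xi>l ^ j * (rho A B (R t) 0 - ev 1)"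
      using rho_bounds(1)[of 0] \<xi>l_pos unfolding eps_def by (intro mult_left_mono) auto
    then show ?case unfolding real_norm_def mult.assoc using elim by linarith
  qed
qed

lemma rho_vanishes:
  assumes "j \<le> K"
  shows "vanishes 2 (\<lambda>t. rho A B (R t) j - ev 1)"
proof -
  have "\<forall>\<^sub>F t in F. norm (rho A B (R t) j - ev 1) \<le> \<xi>u ^ j * (ev CARD('n) - ev 1) * (eps t)\<^sup>2"
    using rho_convergence[OF assms] runs
  proof eventually_elim
    case (elim t)
    interpret lanczos_run A B ev v M m K "R t" by fact
    have "\<xi>u ^ j * (rho A B (R t) 0 - ev 1) \<le> \<xi>u ^ j * ((ev CARD('n) - ev 1) * (eps t)\<^sup>2)"
      using rho_bounds(2)[of 0] \<xi>u_pos unfolding eps_def by (intro mult_left_mono) auto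
    moreover have "0 \<le> rho A B (R t) j - ev 1"
      using rayleigh_ge_ev1[OF iter_nonzero[OF assms]] by simp
    ultimately show ?case using elim by (simp add: mult.assoc)
  qed
  then show ?thesis unfolding vanishes_def by (rule exI)
qed

lemma rho_diff_vanishes:
  assumes "i \<le> K" and "j \<le> K"
  shows "vanishes 2 (\<lambda>t. rho A B (R t) i - rho A B (R t) j)"
  using vanishes_diff[OF rho_vanishes[OF assms(1)] rho_vanishes[OF assms(2)]] by simp

lemma sin_vanishes:
  assumes "j \<le> K"
  shows "vanishes 1 (\<lambda>t. sin (\<theta> j t))"
proof (rule vanishes_power2_imp, rule vanishes_bound[OF rho_vanishes[OF assms]])
  show "\<forall>\<^sub>F t in F. norm ((sin (\<theta> j t))\<^sup>2) \<le> 1 / (ev 2 - ev 1) * norm (rho A B (R t) j - ev 1)"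
    using runs
  proof eventually_elim
    case (elim t)
    interpret lanczos_run A B ev v M m K "R t" by fact
    show ?case
      using rho_bounds(1)[OF assms] gap rayleigh_ge_ev1[OF iter_nonzero[OF assms]]
      by (simp add: pos_le_divide_eq mult.commute)
  qed
qed

lemma sin_exceeds:
  assumes "j \<le> K"
  shows "exceeds 1 (\<lambda>t. sin (\<theta> j t))"
proof -
  have "exceeds 2 (\<lambda>t. sin (\<theta> j t) * sin (\<theta> j t))"
  proof (rule exceeds_bound[OF rho_exceeds[OF assms]])
    show "0 < 1 / (ev CARD('n) - ev 1)" using ev_1_less_top by simp
    show "\<forall>\<^sub>F t in F. 1 / (ev CARD('n) - ev 1) * norm (rho A B (R t) j - ev 1)
        \<le> norm (sin (\<theta> j t) * sin (\<theta> j t))"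
      using runs
    proof eventually_elim
      case (elim t)
      interpret lanczos_run A B ev v M m K "R t" by fact
      show ?case
        using rho_bounds(2)[OF assms] ev_1_less_top rayleigh_ge_ev1[OF iter_nonzero[OF assms]]
        by (simp add: pos_divide_le_eq mult.commute power2_eq_square abs_mult)
    qed
  qed
  then have "exceeds (1 + 1) (\<lambda>t. sin (\<theta> j t) * sin (\<theta> j t))" by (simp only: one_add_one)
  then show ?thesis
    using sin_vanishes[OF assms] by (rule exceeds_cancel_bilinear[OF bounded_bilinear_mult])
qed

lemma x_bounded: "j \<le> K \<Longrightarrow> vanishes 0 (x j)"
  using lanczos_run.iter_normalized
  by (intro vanishes_norm_in[THEN iffD1] vanishes_cong[OF vanishes_const[of 1]] run_fact)

lemma x_exceeds: "j \<le> K \<Longrightarrow> exceeds 0 (x j)"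
  using lanczos_run.iter_normalized
  by (intro exceeds_norm_in[THEN iffD1] exceeds_cong[OF exceeds_const[of 1]] run_fact) auto

lemma c_power2: "j \<le> K \<Longrightarrow> \<forall>\<^sub>F t in F. (c j t)\<^sup>2 = 1 - (sin (\<theta> j t))\<^sup>2"
proof (rule run_fact)
  fix t assume "j \<le> K" and "lanczos_run A B ev v M m K (R t)"
  then interpret lanczos_run A B ev v M m K "R t" by simp
  show "(c j t)\<^sup>2 = 1 - (sin (\<theta> j t))\<^sup>2"
    using cos_angle_v1(1)[OF iter_normalized[OF \<open>j \<le> K\<close>]] by (simp add: theta_def sin_squared_eq)
qed

lemma c_bounded: "j \<le> K \<Longrightarrow> vanishes 0 (c j)"
  by (intro vanishes_inner[OF vanishes_const vanishes_const_matrix[OF x_bounded]]) auto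

lemma c_exceeds:
  assumes "j \<le> K"
  shows "exceeds 0 (c j)"
proof -
  have "vanishes (Suc 0) (\<lambda>t. (sin (\<theta> j t))\<^sup>2)"
    unfolding power2_eq_square
    by (rule vanishes_mult[OF sin_vanishes[OF assms] sin_vanishes[OF assms]]) simp
  then have "exceeds 0 (\<lambda>t. 1 - (sin (\<theta> j t))\<^sup>2)" by (intro exceeds_diff exceeds_const) auto
  then have "exceeds 0 (\<lambda>t. (c j t)\<^sup>2)" using c_power2[OF assms] by (rule exceeds_cong)
  then have "exceeds (0 + 0) (\<lambda>t. c j t * c j t)" by (simp add: power2_eq_square)
  then show ?thesis
    using c_bounded[OF assms] by (rule exceeds_cancel_bilinear[OF bounded_bilinear_mult])
qed

lemma f_vanishes:
  assumes "j \<le> K"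
  shows "vanishes 1 (f j)"
proof -
  have "\<forall>\<^sub>F t in F. norm_in B (f j t) = sin (\<theta> j t)"
  proof (rule run_fact)
    fix t assume "lanczos_run A B ev v M m K (R t)"
    then interpret lanczos_run A B ev v M m K "R t" .
    note x1 = iter_normalized[OF assms]
    have "(norm_in B (f j t))\<^sup>2 = (sin (\<theta> j t))\<^sup>2"
      using off_v1_B_form[of "x j t"] cos_angle_v1(2)[OF x1]
      by (simp add: norm_in_sq[OF spd_B] theta_def)
    then show "norm_in B (f j t) = sin (\<theta> j t)"
      using norm_in_nonneg[OF spd_B] cos_angle_v1(3)[OF x1] by (simp add: theta_def)
  qed
  then have "vanishes 1 (\<lambda>t. norm_in B (f j t))" by (rule vanishes_cong[OF sin_vanishes[OF assms]])
  then show ?thesis by (simp add: vanishes_norm_in)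
qed

lemma N_diff: "N i t - N j t = - ((rho A B (R t) i - rho A B (R t) j) *\<^sub>R B)"
  by (simp add: shifted_def algebra_simps)

lemma N_diff_vanishes: "i \<le> K \<Longrightarrow> j \<le> K \<Longrightarrow> vanishes 2 (\<lambda>t. N i t - N j t)"
  unfolding N_diff
  by (intro vanishes_minus vanishes_scaleR[OF rho_diff_vanishes vanishes_const]) auto

lemma N_bounded: "j \<le> K \<Longrightarrow> vanishes 0 (N j)"
proof -
  assume "j \<le> K"
  then have "vanishes 0 (\<lambda>t. (A - ev 1 *\<^sub>R B) - (rho A B (R t) j - ev 1) *\<^sub>R B)"
    by (intro vanishes_diff vanishes_const vanishes_scaleR[OF rho_vanishes vanishes_const]) auto
  then show ?thesis by (simp add: shifted_def algebra_simps)
qed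

lemma r_vanishes:
  assumes "j \<le> K"
  shows "vanishes 1 (r j)"
proof -
  have "r j t = N j t *v f j t - ((rho A B (R t) j - ev 1) * c j t) *\<^sub>R (B *v v 1)" for t
  proof -
    have "N j t *v v 1 = - ((rho A B (R t) j - ev 1) *\<^sub>R (B *v v 1))"
      by (simp add: shifted_mult A_v1 algebra_simps del: One_nat_def)
    then show ?thesis
      by (simp add: residual_def matrix_vector_mult_diff_distrib matrix_vector_mult_scaleR)
  qed
  moreover have "vanishes 1 (\<lambda>t. N j t *v f j t)"
    by (rule vanishes_matrix_vector[OF N_bounded f_vanishes]) (use assms in auto)
  moreover have "vanishes 2 (\<lambda>t. (rho A B (R t) j - ev 1) * c j t)"
    by (rule vanishes_mult[OF rho_vanishes c_bounded]) (use assms in auto)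
  then have "vanishes 1 (\<lambda>t. ((rho A B (R t) j - ev 1) * c j t) *\<^sub>R (B *v v 1))"
    by (rule vanishes_scaleR[OF _ vanishes_const]) simp
  ultimately show ?thesis by (simp add: vanishes_diff)
qed

text \<open>Since \<open>r\<^sub>j\<close> is orthogonal to \<open>x\<^sub>j\<close>, the product \<open>f\<^sub>j\<^sup>T r\<^sub>j\<close> equals \<open>(\<rho>\<^sub>j - \<lambda>\<^sub>1) cos\<^sup>2 \<theta>\<^sub>j\<close>, which
  has exact order 2, while \<open>f\<^sub>j\<close> has order 1.\<close>

lemma r_exceeds:
  assumes "j \<le> K"
  shows "exceeds 1 (r j)"
proof -
  have "exceeds (2 + (0 + 0)) (\<lambda>t. (rho A B (R t) j - ev 1) * (c j t * c j t))"
    by (intro exceeds_mult rho_exceeds c_exceeds assms)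
  then have "exceeds (1 + 1) (\<lambda>t. (rho A B (R t) j - ev 1) * (c j t * c j t))"
    by (simp only: add_0_right one_add_one)
  moreover have "\<forall>\<^sub>F t in F. f j t \<bullet> r j t = (rho A B (R t) j - ev 1) * (c j t * c j t)"
  proof (rule run_fact)
    fix t assume "lanczos_run A B ev v M m K (R t)"
    then interpret lanczos_run A B ev v M m K "R t" .
    have "v 1 \<bullet> r j t = - ((rho A B (R t) j - ev 1) * c j t)"
      unfolding residual_def shifted_inner[symmetric]
      by (simp add: shifted_mult A_v1 B_inner inner_diff_left algebra_simps del: One_nat_def)
    then show "f j t \<bullet> r j t = (rho A B (R t) j - ev 1) * (c j t * c j t)"
      using residual_orthogonal[OF spd_B iter_nonzero[OF assms], of A]
      by (simp add: inner_diff_left)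
  qed
  ultimately have "exceeds (1 + 1) (\<lambda>t. f j t \<bullet> r j t)" by (rule exceeds_cong)
  then show ?thesis using f_vanishes[OF assms] by (rule exceeds_cancel_inner)
qed


subsection \<open>The angle assumption\<close>

lemma Wspace_bound:
  obtains \<kappa> where "\<kappa> > 0"
    and "\<forall>\<^sub>F t in F. \<forall>j\<in>{1..K}. \<forall>w\<in>Wspace (R t) j. \<forall>\<alpha>. norm w \<le> \<kappa> * norm (\<alpha> *\<^sub>R v 1 + w)"
proof -
  obtain \<delta> where \<delta>: "\<delta> > 0" "\<forall>\<^sub>F t in F. \<forall>k\<in>{1..K}. \<delta> \<le> subspace_angle (v 1) (Wspace (R t) k)"
    using angle by (auto simp: angle_assumption_def)
  \<comment> \<open>\<open>\<delta>\<close> may exceed every angle that occurs, if \<open>W\<^sub>j\<close> is trivial; the cap keeps the sine positive.\<close>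
  define \<gamma> where "\<gamma> = min \<delta> (pi / 2)"
  have \<gamma>: "0 < \<gamma>" "\<gamma> < pi" using \<delta>(1) pi_gt_zero by (auto simp: \<gamma>_def min_def)
  show ?thesis
  proof (rule that)
    show "1 / sin \<gamma> > 0" using sin_gt_zero[OF \<gamma>] by simp
    show "\<forall>\<^sub>F t in F. \<forall>j\<in>{1..K}. \<forall>w\<in>Wspace (R t) j. \<forall>\<alpha>.
        norm w \<le> 1 / sin \<gamma> * norm (\<alpha> *\<^sub>R v 1 + w)"
      using \<delta>(2)
    proof eventually_elim
      case (elim t)
      show ?case
      proof (intro ballI allI)
        fix j w \<alpha> assume j: "j \<in> {1..K}" and w: "w \<in> Wspace (R t) j"
        have "\<gamma> \<le> \<delta>" by (simp add: \<gamma>_def)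
        also have "\<delta> \<le> subspace_angle (v 1) (Wspace (R t) j)" using elim j by blast
        finally show "norm w \<le> 1 / sin \<gamma> * norm (\<alpha> *\<^sub>R v 1 + w)"
          by (intro norm_le_norm_add_off_subspace[OF subspace_Wspace \<gamma> _ w])
      qed
    qed
  qed
qed

text \<open>A vector of \<open>W\<^sub>j\<close> can only be close to a multiple of \<open>v\<^sub>1\<close> by being small itself.\<close>

lemma vanishes_Wspace_part:
  assumes "j \<in> {1..K}" and "\<forall>\<^sub>F t in F. w t \<in> Wspace (R t) j"
    and "vanishes n (\<lambda>t. \<alpha> t *\<^sub>R v 1 + w t)"
  shows "vanishes n w"
proof -
  obtain \<kappa> where \<kappa>: "\<forall>\<^sub>F t in F. \<forall>j\<in>{1..K}. \<forall>w\<in>Wspace (R t) j. \<forall>\<alpha>.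
      norm w \<le> \<kappa> * norm (\<alpha> *\<^sub>R v 1 + w)"
    using Wspace_bound by blast
  have "\<forall>\<^sub>F t in F. norm (w t) \<le> \<kappa> * norm (\<alpha> t *\<^sub>R v 1 + w t)"
    using \<kappa> assms(2) by eventually_elim (use assms(1) in blast)
  then show ?thesis by (rule vanishes_bound[OF assms(3)])
qed

text \<open>On \<open>W\<^sub>j\<close> the form of \<open>A - \<lambda>\<^sub>1 B\<close> is uniformly positive, being zero only along \<open>v\<^sub>1\<close>.\<close>

lemma form_exceeds:
  assumes "i \<le> K" and "j \<in> {1..K}" and "\<forall>\<^sub>F t in F. w t \<in> Wspace (R t) j"
    and "vanishes 0 w" and "exceeds 0 w"
  shows "exceeds 0 (\<lambda>t. w t \<bullet> (N i t *v w t))"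
proof -
  let ?u = "\<lambda>t. w t - (v 1 \<bullet> (B *v w t)) *\<^sub>R v 1"
  let ?q = "\<lambda>t. w t \<bullet> (A *v w t) - ev 1 * (w t \<bullet> (B *v w t))"
  obtain \<kappa> where \<kappa>: "\<kappa> > 0" "\<forall>\<^sub>F t in F. \<forall>j\<in>{1..K}. \<forall>w\<in>Wspace (R t) j. \<forall>\<alpha>.
      norm w \<le> \<kappa> * norm (\<alpha> *\<^sub>R v 1 + w)"
    by (rule Wspace_bound)
  have "\<forall>\<^sub>F t in F. (1 / \<kappa>) * norm (w t) \<le> norm (?u t)"
    using \<kappa>(2) assms(3)
  proof eventually_elim
    case (elim t)
    then have "norm (w t) \<le> \<kappa> * norm ((- (v 1 \<bullet> (B *v w t))) *\<^sub>R v 1 + w t)"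
      using assms(2) by blast
    then show ?case using \<kappa>(1) by (simp add: pos_divide_le_eq mult.commute)
  qed
  then have "exceeds 0 ?u" using \<kappa>(1) by (intro exceeds_bound[OF assms(5), of "1 / \<kappa>"]) auto
  then have "exceeds 0 (\<lambda>t. norm_in B (?u t))" by (simp add: exceeds_norm_in)
  then have "exceeds (0 + 0) (\<lambda>t. norm_in B (?u t) * norm_in B (?u t))" by (intro exceeds_mult)
  then have "exceeds 0 (\<lambda>t. norm_in B (?u t) * norm_in B (?u t))" by simp
  then have "exceeds 0 ?q"
  proof (rule exceeds_bound[where c = "ev 2 - ev 1"])
    show "0 < ev 2 - ev 1" using gap by simp
    show "\<forall>\<^sub>F t in F. (ev 2 - ev 1) * norm (norm_in B (?u t) * norm_in B (?u t)) \<le> norm (?q t)"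
    proof (intro always_eventually allI)
      fix t
      have "norm (norm_in B (?u t) * norm_in B (?u t)) = (norm_in B (?u t))\<^sup>2"
        by (simp add: power2_eq_square)
      also have "\<dots> = w t \<bullet> (B *v w t) - (v 1 \<bullet> (B *v w t))\<^sup>2"
        using off_v1_B_form[of "w t"] by (simp add: norm_in_sq[OF spd_B])
      finally have eq: "norm (norm_in B (?u t) * norm_in B (?u t))
          = w t \<bullet> (B *v w t) - (v 1 \<bullet> (B *v w t))\<^sup>2" .
      show "(ev 2 - ev 1) * norm (norm_in B (?u t) * norm_in B (?u t)) \<le> norm (?q t)"
        unfolding eq unfolding real_norm_def using spectral_gap(1)[of "w t"] abs_ge_self by (rule order_trans)
    qed
  qed
  moreover have "vanishes 0 (\<lambda>t. w t \<bullet> (B *v w t))"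
    by (intro vanishes_inner[OF assms(4) vanishes_const_matrix[OF assms(4)]]) simp
  then have "vanishes (Suc 0) (\<lambda>t. (rho A B (R t) i - ev 1) * (w t \<bullet> (B *v w t)))"
    by (rule vanishes_mult[OF rho_vanishes[OF assms(1)]]) simp
  ultimately show ?thesis unfolding shifted_form_split by (rule exceeds_diff)
qed


subsection \<open>The size of the updates\<close>

lemma h_in_Wspace: "j < K \<Longrightarrow> \<forall>\<^sub>F t in F. h j t \<in> Wspace (R t) (Suc j)"
  by (rule run_fact) (rule lanczos_run.update_in_Wspace)

lemma iter_Suc_ev: "j < K \<Longrightarrow> \<forall>\<^sub>F t in F. s j t *\<^sub>R x (Suc j) t = a j t *\<^sub>R x j t + h j t"
  by (rule run_fact) (rule lanczos_run.iter_Suc)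

text \<open>Up to a small error, \<open>x\<^sub>j + h\<^sub>j / a\<^sub>j\<close> is a nonzero multiple of \<open>v\<^sub>1\<close> plus a vector of \<open>W\<^sub>j\<^sub>+\<^sub>1\<close>. By
  the angle assumption it is bounded away from \<open>0\<close>, while \<open>a\<^sub>j\<close> times it is \<open>s\<^sub>j x\<^sub>j\<^sub>+\<^sub>1\<close>, of bounded
  size.\<close>

lemma a_bounded:
  assumes j: "j < K"
  shows "vanishes 0 (a j)"
proof -
  \<comment> \<open>Where \<open>a\<^sub>j = 0\<close> this is \<open>0\<close>, and the product with \<open>a\<^sub>j\<close> is bounded trivially.\<close>
  define w where "w t = (1 / a j t) *\<^sub>R h j t" for t
  have jK: "j \<le> K" and SK: "Suc j \<le> K" and S1: "Suc j \<in> {1..K}" using j by auto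
  obtain \<kappa> where \<kappa>: "\<kappa> > 0" "\<forall>\<^sub>F t in F. \<forall>j\<in>{1..K}. \<forall>w\<in>Wspace (R t) j. \<forall>\<alpha>.
      norm w \<le> \<kappa> * norm (\<alpha> *\<^sub>R v 1 + w)"
    by (rule Wspace_bound)
  have "exceeds (0 + 0) (\<lambda>t. c j t *\<^sub>R v 1)"
    by (intro exceeds_scaleR c_exceeds jK exceeds_const v1_nonzero)
  then have "exceeds 0 (\<lambda>t. c j t *\<^sub>R v 1)" by simp
  moreover have "0 < 1 / (1 + \<kappa>)" using \<kappa>(1) by simp
  moreover have "\<forall>\<^sub>F t in F. 1 / (1 + \<kappa>) * norm (c j t *\<^sub>R v 1) \<le> norm (c j t *\<^sub>R v 1 + w t)"
    using \<kappa>(2) h_in_Wspace[OF j]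
  proof eventually_elim
    case (elim t)
    have "w t \<in> Wspace (R t) (Suc j)"
      using elim(2) by (simp add: w_def subspace_scale[OF subspace_Wspace])
    then have "norm (w t) \<le> \<kappa> * norm (c j t *\<^sub>R v 1 + w t)" using elim(1) S1 by blast
    moreover have "norm (c j t *\<^sub>R v 1) \<le> norm (c j t *\<^sub>R v 1 + w t) + norm (w t)"
      using norm_triangle_ineq4[of "c j t *\<^sub>R v 1 + w t" "w t"] by simp
    ultimately have "norm (c j t *\<^sub>R v 1) \<le> (1 + \<kappa>) * norm (c j t *\<^sub>R v 1 + w t)"
      by (simp only: distrib_right mult_1_left)
    moreover have "0 < 1 + \<kappa>" using \<kappa>(1) by simp
    ultimately show ?case by (simp only: pos_divide_le_eq times_divide_eq_left mult_1_left mult.commute)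
  qed
  ultimately have "exceeds 0 (\<lambda>t. c j t *\<^sub>R v 1 + w t)" by (rule exceeds_bound)
  then have "exceeds 0 (\<lambda>t. (c j t *\<^sub>R v 1 + w t) + f j t)"
    by (rule exceeds_add) (use f_vanishes[OF jK] in simp)
  then have "exceeds 0 (\<lambda>t. x j t + w t)" by (simp add: algebra_simps)
  then have "exceeds 0 (\<lambda>t. norm (x j t + w t))" by (simp add: exceeds_norm)
  then show ?thesis
  proof (rule vanishes_cancel)
    have "vanishes 0 (\<lambda>t. s j t *\<^sub>R x (Suc j) t)"
      by (rule vanishes_scaleR[OF s_bounded[OF j] x_bounded[OF SK]]) simp
    then have "vanishes 0 (\<lambda>t. norm (x j t + w t) *\<^sub>R a j t)"
    proof (rule vanishes_bound)
      show "\<forall>\<^sub>F t in F. norm (norm (x j t + w t) *\<^sub>R a j t) \<le> 1 * norm (s j t *\<^sub>R x (Suc j) t)"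
        using iter_Suc_ev[OF j]
      proof eventually_elim
        case (elim t)
        show ?case
        proof (cases "a j t = 0")
          case False
          then have "s j t *\<^sub>R x (Suc j) t = a j t *\<^sub>R (x j t + w t)"
            by (simp add: elim w_def scaleR_add_right)
          then show ?thesis by (simp add: abs_mult mult.commute)
        qed simp
      qed
    qed
    then show "vanishes (0 + 0) (\<lambda>t. norm (x j t + w t) *\<^sub>R a j t)" by simp
  qed
qed

text \<open>Both \<open>x\<^sub>j\<close> and \<open>x\<^sub>j\<^sub>+\<^sub>1\<close> are first-order close to multiples of \<open>v\<^sub>1\<close>, hence so is their combination
  \<open>h\<^sub>j\<close>; but \<open>h\<^sub>j\<close> lies in \<open>W\<^sub>j\<^sub>+\<^sub>1\<close>.\<close>

lemma h_vanishes:
  assumes j: "j < K"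
  shows "vanishes 1 (h j)"
proof -
  have jK: "j \<le> K" and SK: "Suc j \<le> K" and S1: "Suc j \<in> {1..K}" using j by auto
  have "vanishes 1 (\<lambda>t. s j t *\<^sub>R f (Suc j) t - a j t *\<^sub>R f j t)"
    by (intro vanishes_diff vanishes_scaleR[OF s_bounded[OF j] f_vanishes[OF SK]]
        vanishes_scaleR[OF a_bounded[OF j] f_vanishes[OF jK]]) auto
  then have "vanishes 1 (\<lambda>t. (a j t * c j t - s j t * c (Suc j) t) *\<^sub>R v 1 + h j t)"
  proof (rule vanishes_cong)
    show "\<forall>\<^sub>F t in F. (a j t * c j t - s j t * c (Suc j) t) *\<^sub>R v 1 + h j t
        = s j t *\<^sub>R f (Suc j) t - a j t *\<^sub>R f j t"
      using iter_Suc_ev[OF j] by eventually_elim (simp add: algebra_simps)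
  qed
  then show ?thesis by (rule vanishes_Wspace_part[OF S1 h_in_Wspace[OF j]])
qed

lemma a_exceeds:
  assumes j: "j < K"
  shows "exceeds 0 (a j)"
proof -
  have jK: "j \<le> K" and SK: "Suc j \<le> K" using j by auto
  have "exceeds (0 + 0) (\<lambda>t. s j t *\<^sub>R x (Suc j) t)"
    by (intro exceeds_scaleR s_exceeds x_exceeds j SK)
  then have "exceeds 0 (\<lambda>t. s j t *\<^sub>R x (Suc j) t - h j t)"
    by (intro exceeds_diff) (use h_vanishes[OF j] in simp_all)
  then have "exceeds 0 (\<lambda>t. a j t *\<^sub>R x j t)"
    by (rule exceeds_cong) (use iter_Suc_ev[OF j] in eventually_elim, simp)
  then have "exceeds (0 + 0) (\<lambda>t. a j t *\<^sub>R x j t)" by simp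
  then show ?thesis using x_bounded[OF jK]
    by (rule exceeds_cancel_bilinear[OF bounded_bilinear.flip[OF bounded_bilinear_scaleR]])
qed

text \<open>The new residual is orthogonal to \<open>M r\<^sub>j\<close> while \<open>r\<^sub>j\<^sup>T M r\<^sub>j\<close> has exact order 2; so the residual,
  and with it the iterate, must have moved by an amount of first order.\<close>

lemma h_exceeds:
  assumes j: "j < K"
  shows "exceeds 1 (h j)"
proof -
  have jK: "j \<le> K" and SK: "Suc j \<le> K" using j by auto
  let ?Mr = "\<lambda>t. M *v r j t"
  let ?e = "\<lambda>t. (a j t * (rho A B (R t) (Suc j) - rho A B (R t) j)) * ((B *v x j t) \<bullet> ?Mr t)"
  have Mr: "vanishes 1 ?Mr" by (intro vanishes_const_matrix r_vanishes jK)
  obtain b where b: "b > 0" "\<And>u. b * (norm u)\<^sup>2 \<le> u \<bullet> (M *v u)" using spd_coercive[OF spd_M] by auto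
  have "exceeds (1 + 1) (\<lambda>t. norm (r j t) * norm (r j t))"
    by (intro exceeds_mult) (simp_all only: exceeds_norm r_exceeds[OF jK])
  then have "exceeds (1 + 1) (\<lambda>t. r j t \<bullet> ?Mr t)" using b(1)
  proof (rule exceeds_bound)
    show "\<forall>\<^sub>F t in F. b * norm (norm (r j t) * norm (r j t)) \<le> norm (r j t \<bullet> ?Mr t)"
      using b(2) abs_ge_self order_trans
      by (intro always_eventually allI) (simp add: power2_eq_square, blast)
  qed
  then have "exceeds (0 + (1 + 1)) (\<lambda>t. a j t * (r j t \<bullet> ?Mr t))"
    by (intro exceeds_mult a_exceeds j)
  then have main: "exceeds 2 (\<lambda>t. a j t * (r j t \<bullet> ?Mr t))" by (simp only: add_0_left one_add_one)
  have e1: "vanishes 2 (\<lambda>t. a j t * (rho A B (R t) (Suc j) - rho A B (R t) j))"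
    by (rule vanishes_mult[OF a_bounded[OF j] rho_diff_vanishes[OF SK jK]]) simp
  have e2: "vanishes 1 (\<lambda>t. (B *v x j t) \<bullet> ?Mr t)"
    by (rule vanishes_inner[OF vanishes_const_matrix[OF x_bounded[OF jK]] Mr]) simp
  have "vanishes (Suc 2) ?e" by (rule vanishes_mult[OF e1 e2]) simp
  with main have "exceeds 2 (\<lambda>t. a j t * (r j t \<bullet> ?Mr t) - ?e t)" by (rule exceeds_diff)
  then have "exceeds 2 (\<lambda>t. - (a j t * (r j t \<bullet> ?Mr t) - ?e t))" by (rule exceeds_minus)
  then have "exceeds 2 (\<lambda>t. ?Mr t \<bullet> (N (Suc j) t *v h j t))"
  proof (rule exceeds_cong)
    show "\<forall>\<^sub>F t in F. ?Mr t \<bullet> (N (Suc j) t *v h j t) = - (a j t * (r j t \<bullet> ?Mr t) - ?e t)"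
      using runs iter_Suc_ev[OF j]
    proof eventually_elim
      case (elim t)
      interpret lanczos_run A B ev v M m K "R t" by fact
      have "?Mr t \<bullet> (s j t *\<^sub>R (N (Suc j) t *v x (Suc j) t)) = 0"
        using residual_orthogonal_trial[OF j preconditioned_residual_in_trial[OF j]]
        by (simp add: residual_def)
      then have "?Mr t \<bullet> (N (Suc j) t *v (a j t *\<^sub>R x j t + h j t)) = 0"
        using elim(2) by (metis matrix_vector_mult_scaleR)
      moreover have "N (Suc j) t *v x j t
          = r j t - (rho A B (R t) (Suc j) - rho A B (R t) j) *\<^sub>R (B *v x j t)"
        by (simp add: residual_def shifted_mult algebra_simps)
      ultimately show ?case
        by (simp add: matrix_vector_right_distrib matrix_vector_mult_scaleR inner_add_right
            inner_diff_right inner_commute algebra_simps)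
    qed
  qed
  then have "exceeds (1 + 1) (\<lambda>t. ?Mr t \<bullet> (N (Suc j) t *v h j t))" by (simp only: one_add_one)
  then have "exceeds 1 (\<lambda>t. N (Suc j) t *v h j t)" using Mr by (rule exceeds_cancel_inner)
  then have "exceeds (0 + 1) (\<lambda>t. N (Suc j) t *v h j t)" by simp
  then show ?thesis using N_bounded[OF SK] by (rule exceeds_cancel_matrix_vector)
qed


subsection \<open>Search directions\<close>

lemma p_bounded: "j < K \<Longrightarrow> vanishes 0 (p j)"
proof -
  assume j: "j < K"
  have "vanishes 0 (\<lambda>t. norm_in B (p j t))"
  proof (rule vanishes_bound[OF vanishes_const[of 1]])
    show "\<forall>\<^sub>F t in F. norm (norm_in B (p j t)) \<le> 1 * norm (1 :: real)"
      by (rule run_fact)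
        (use lanczos_run.norm_in_dir_le[OF _ j] norm_in_nonneg[OF spd_B] in simp)
  qed
  then show ?thesis by (simp add: vanishes_norm_in)
qed

lemma p_form_exceeds:
  assumes j: "j < K" and "i \<le> K" and "exceeds 1 (d j)"
  shows "exceeds 0 (\<lambda>t. p j t \<bullet> (N i t *v p j t))"
proof (rule form_exceeds)
  show "i \<le> K" by fact
  show "Suc j \<in> {1..K}" using j by auto
  show "\<forall>\<^sub>F t in F. p j t \<in> Wspace (R t) (Suc j)"
    by (rule run_fact) (rule lanczos_run.dir_in_Wspace[OF _ j])
  show "vanishes 0 (p j)" by (rule p_bounded[OF j])
  have "\<forall>\<^sub>F t in F. norm_in B (p j t) = 1"
    using runs exceeds_nonzero[OF assms(3)]
  proof eventually_elim
    case (elim t)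
    interpret lanczos_run A B ev v M m K "R t" by fact
    show ?case using elim(2) norm_in_eq_0_iff[OF spd_B] by (intro norm_in_dir[OF j]) auto
  qed
  then have "exceeds 0 (\<lambda>t. norm_in B (p j t))"
    by (intro exceeds_cong[OF exceeds_const[of 1]]) auto
  then show "exceeds 0 (p j)" by (simp add: exceeds_norm_in)
qed

text \<open>Both \<open>r\<^sub>j\<close> and \<open>r\<^sub>j\<^sub>+\<^sub>1\<close> are orthogonal to \<open>p\<^sub>j\<^sub>-\<^sub>1\<close>, so the update \<open>h\<^sub>j\<close> is conjugate to \<open>p\<^sub>j\<^sub>-\<^sub>1\<close> up to
  second order: projecting \<open>p\<^sub>j\<^sub>-\<^sub>1\<close> out hardly changes it.\<close>

lemma dir_unnorm_near_update:
  "j < K \<Longrightarrow> vanishes 2 (\<lambda>t. dir_unnorm A B (R t) j - h j t) \<and> exceeds 1 (d j)"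
proof (induction j)
  case 0
  have "\<forall>\<^sub>F t in F. dir_unnorm A B (R t) 0 = h 0 t"
  proof (intro always_eventually allI)
    fix t obtain \<omega> where "h 0 t = g 0 t + \<omega> *\<^sub>R prev_dir (R t) 0" by (rule update_eq)
    then show "dir_unnorm A B (R t) 0 = h 0 t" by (simp add: dir_unnorm_def prev_dir_def)
  qed
  then show ?case
    using exceeds_cong[OF h_exceeds[OF 0]] 
    by (auto simp: exceeds_norm_in intro!: vanishes_cong[OF vanishes_zero] elim: eventually_mono)
next
  case (Suc j)
  let ?P = "\<lambda>t. p j t \<bullet> (N j t *v p j t)"
  let ?\<tau> = "\<lambda>t. (p j t \<bullet> (N j t *v h (Suc j) t)) / ?P t"
  have j: "j < K" and jK: "j \<le> K" and SK: "Suc j \<le> K" and SSK: "Suc (Suc j) \<le> K"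
    using Suc.prems by auto
  have P: "exceeds 0 ?P" using Suc by (intro p_form_exceeds) auto
  have px: "vanishes 0 (\<lambda>t. p j t \<bullet> (B *v x i t))" if "i \<le> K" for i
    by (rule vanishes_inner[OF p_bounded[OF j] vanishes_const_matrix[OF x_bounded[OF that]]]) simp
  have e: "vanishes 2 (\<lambda>t. \<alpha> t * (rho A B (R t) i - rho A B (R t) j) * (p j t \<bullet> (B *v x i t)))"
    if "i \<le> K" "vanishes 0 \<alpha>" for i \<alpha>
  proof (rule vanishes_mult[OF _ px[OF that(1)]])
    show "vanishes 2 (\<lambda>t. \<alpha> t * (rho A B (R t) i - rho A B (R t) j))"
      by (rule vanishes_mult[OF that(2) rho_diff_vanishes[OF that(1) jK]]) simp
  qed simp
  have "vanishes 2 (\<lambda>t. s (Suc j) t * (rho A B (R t) (Suc (Suc j)) - rho A B (R t) j) * (p j t \<bullet> (B *v x (Suc (Suc j)) t))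
      - a (Suc j) t * (rho A B (R t) (Suc j) - rho A B (R t) j) * (p j t \<bullet> (B *v x (Suc j) t)))"
    by (intro vanishes_diff e SSK SK s_bounded a_bounded Suc.prems)
  then have "vanishes 2 (\<lambda>t. p j t \<bullet> (N j t *v h (Suc j) t))"
  proof (rule vanishes_cong)
    show "\<forall>\<^sub>F t in F. p j t \<bullet> (N j t *v h (Suc j) t)
        = s (Suc j) t * (rho A B (R t) (Suc (Suc j)) - rho A B (R t) j) * (p j t \<bullet> (B *v x (Suc (Suc j)) t))
          - a (Suc j) t * (rho A B (R t) (Suc j) - rho A B (R t) j) * (p j t \<bullet> (B *v x (Suc j) t))"
      using runs iter_Suc_ev[OF Suc.prems]
    proof eventually_elim
      case (elim t)
      interpret lanczos_run A B ev v M m K "R t" by fact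
      have "p j t \<bullet> r (Suc j) t = 0" "p j t \<bullet> r (Suc (Suc j)) t = 0"
        using prev_dir_residual[OF SK] prev_dir_residual_Suc[OF Suc.prems]
        by (simp_all add: prev_dir_def)
      then have px: "p j t \<bullet> (N j t *v x i t) = (rho A B (R t) i - rho A B (R t) j) * (p j t \<bullet> (B *v x i t))"
        if "i = Suc j \<or> i = Suc (Suc j)" for i
        using that by (auto simp: residual_def shifted_mult inner_diff_right algebra_simps)
      have "h (Suc j) t = s (Suc j) t *\<^sub>R x (Suc (Suc j)) t - a (Suc j) t *\<^sub>R x (Suc j) t"
        using elim(2) by simp
      then show ?case
        by (simp add: matrix_vector_mult_diff_distrib matrix_vector_mult_scaleR inner_diff_right px mult.assoc)
    qed
  qed
  then have "vanishes 2 ?\<tau>" by (intro vanishes_divide[OF P]) (simp only: add_0_left)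
  then have "vanishes 2 (\<lambda>t. - (?\<tau> t *\<^sub>R p j t))"
    by (intro vanishes_minus vanishes_scaleR[OF _ p_bounded[OF j]]) auto
  moreover have "\<forall>\<^sub>F t in F. dir_unnorm A B (R t) (Suc j) - h (Suc j) t = - (?\<tau> t *\<^sub>R p j t)"
    using runs exceeds_nonzero[OF P]
  proof eventually_elim
    case (elim t)
    interpret lanczos_run A B ev v M m K "R t" by fact
    show ?case using dir_unnorm_via_update[of "Suc j"] elim(2) by simp
  qed
  ultimately have near: "vanishes 2 (\<lambda>t. dir_unnorm A B (R t) (Suc j) - h (Suc j) t)"
    by (rule vanishes_cong)
  then have "exceeds 1 (\<lambda>t. h (Suc j) t + (dir_unnorm A B (R t) (Suc j) - h (Suc j) t))"
    by (intro exceeds_add h_exceeds[OF Suc.prems]) (simp add: numeral_2_eq_2)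
  then have "exceeds 1 (d (Suc j))" by (simp add: exceeds_norm_in)
  with near show ?case by blast
qed

lemma d_exceeds: "j < K \<Longrightarrow> exceeds 1 (d j)"
  using dir_unnorm_near_update by blast


subsection \<open>Approximate conjugacy\<close>

text \<open>As in conjugate gradients, \<open>(A - \<lambda>\<^sub>1 B) p\<^sub>j\<close> is a combination of consecutive residuals, here up to
  an error of first order.\<close>

definition dir_image_error :: "nat \<Rightarrow> nat \<Rightarrow> 'i \<Rightarrow> real^'n" where
  "dir_image_error i j t =
     N i t *v p j t - (1 / d j t) *\<^sub>R (s j t *\<^sub>R r (Suc j) t - a j t *\<^sub>R r j t)"

lemma dir_image_error_vanishes:
  assumes j: "j < K" and i: "i \<le> K"
  shows "vanishes 1 (dir_image_error i j)"
proof (rule vanishes_cancel[OF d_exceeds[OF j]])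
  have jK: "j \<le> K" and SK: "Suc j \<le> K" using j by auto
  have e1: "vanishes 2 (\<lambda>t. (N i t - N l t) *v x l t)" if "l \<le> K" for l
    by (rule vanishes_matrix_vector[OF N_diff_vanishes[OF i that] x_bounded[OF that]]) simp
  have "vanishes 2 (\<lambda>t. N i t *v (dir_unnorm A B (R t) j - h j t))"
    by (rule vanishes_matrix_vector[OF N_bounded[OF i]]) (use dir_unnorm_near_update[OF j] in auto)
  moreover have "vanishes 2 (\<lambda>t. s j t *\<^sub>R ((N i t - N (Suc j) t) *v x (Suc j) t))"
    by (rule vanishes_scaleR[OF s_bounded[OF j] e1[OF SK]]) simp
  moreover have "vanishes 2 (\<lambda>t. a j t *\<^sub>R ((N i t - N j t) *v x j t))"
    by (rule vanishes_scaleR[OF a_bounded[OF j] e1[OF jK]]) simp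
  ultimately have "vanishes 2 (\<lambda>t. N i t *v (dir_unnorm A B (R t) j - h j t) +
      (s j t *\<^sub>R ((N i t - N (Suc j) t) *v x (Suc j) t) - a j t *\<^sub>R ((N i t - N j t) *v x j t)))"
    by (intro vanishes_add vanishes_diff)
  then have "vanishes 2 (\<lambda>t. d j t *\<^sub>R dir_image_error i j t)"
  proof (rule vanishes_cong)
    show "\<forall>\<^sub>F t in F. d j t *\<^sub>R dir_image_error i j t =
        N i t *v (dir_unnorm A B (R t) j - h j t) +
          (s j t *\<^sub>R ((N i t - N (Suc j) t) *v x (Suc j) t) - a j t *\<^sub>R ((N i t - N j t) *v x j t))"
      using runs iter_Suc_ev[OF j] exceeds_nonzero[OF d_exceeds[OF j]]
    proof eventually_elim
      case (elim t)
      interpret lanczos_run A B ev v M m K "R t" by fact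
      have "d j t *\<^sub>R (N i t *v p j t) = N i t *v dir_unnorm A B (R t) j"
        using dir_unnorm_eq[OF j] by (metis matrix_vector_mult_scaleR)
      moreover have "N i t *v h j t = s j t *\<^sub>R (N i t *v x (Suc j) t) - a j t *\<^sub>R (N i t *v x j t)"
      proof -
        have "h j t = s j t *\<^sub>R x (Suc j) t - a j t *\<^sub>R x j t" using elim(2) by simp
        then show ?thesis by (simp only: matrix_vector_mult_diff_distrib matrix_vector_mult_scaleR)
      qed
      moreover have "d j t *\<^sub>R (1 / d j t) *\<^sub>R (s j t *\<^sub>R r (Suc j) t - a j t *\<^sub>R r j t)
          = s j t *\<^sub>R r (Suc j) t - a j t *\<^sub>R r j t"
        using elim(3) by simp
      ultimately show ?case
        by (simp add: dir_image_error_def scaleR_diff_right matrix_vector_mult_diff_distrib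
            matrix_vector_mult_diff_rdistrib residual_def del: scaleR_scaleR)
    qed
  qed
  then show "vanishes (1 + 1) (\<lambda>t. d j t *\<^sub>R dir_image_error i j t)" by (simp only: one_add_one)
qed

lemma inner_dir_image:
  "u \<bullet> (N i t *v p j t)
     = (s j t * (u \<bullet> r (Suc j) t) - a j t * (u \<bullet> r j t)) / d j t + u \<bullet> dir_image_error i j t"
  by (simp add: dir_image_error_def inner_diff_right)

text \<open>This is where the polynomial assumption enters: \<open>g\<^sub>i = P\<^sub>i r\<^sub>i\<close> with a symmetric matrix \<open>P\<^sub>i\<close> that
  changes little from step to step, so it can be moved from \<open>r\<^sub>i\<close> to \<open>r\<^sub>j\<close>.\<close>

lemma gvec_residual_swap:
  assumes "j < i" and i: "i < K"
  shows "vanishes 3 (\<lambda>t. g i t \<bullet> r j t - r i t \<bullet> g j t)"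
proof -
  have j: "j < K" and iK: "i \<le> K" and jK: "j \<le> K" using assms by auto
  have M: "transpose M = M" using spd_M by (simp add: spd_def)
  obtain q :: "'i \<Rightarrow> nat \<Rightarrow> real poly" where
    q: "\<forall>\<^sub>F t in F. \<forall>k<K. degree (q t k) \<le> m - 1 \<and> g k t = precond_poly A B M (q t k) (x k t) *v r k t"
    and qd: "\<forall>k<K. \<forall>j<k. (\<lambda>t. norm (precond_poly A B M (q t k) (x k t) - precond_poly A B M (q t j) (x j t)))
             \<in> O[F](\<lambda>t. sin (\<theta> j t))"
    using polynomial unfolding polynomial_assumption_def by blast
  define P where "P k t = precond_poly A B M (q t k) (x k t)" for k t
  have "vanishes 1 (\<lambda>t. P i t - P j t)"
    unfolding P_def
    by (rule vanishes_from_bigo_norm[OF _ sin_vanishes[OF jK]]) (use qd i assms(1) in blast)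
  then have "vanishes 2 (\<lambda>t. (P i t - P j t) *v r j t)"
    by (rule vanishes_matrix_vector[OF _ r_vanishes[OF jK]]) simp
  then have "vanishes 3 (\<lambda>t. r i t \<bullet> ((P i t - P j t) *v r j t))"
    by (rule vanishes_inner[OF r_vanishes[OF iK]]) simp
  then show ?thesis
  proof (rule vanishes_cong)
    show "\<forall>\<^sub>F t in F. g i t \<bullet> r j t - r i t \<bullet> g j t = r i t \<bullet> ((P i t - P j t) *v r j t)"
      using q
    proof eventually_elim
      case (elim t)
      then have "g i t = P i t *v r i t" "g j t = P j t *v r j t" using i j by (auto simp: P_def)
      then show ?case
        using precond_poly_self_adjoint[OF symmetric_A symmetric_B M, of "q t i" "x i t" "r i t" "r j t"]
        by (simp add: P_def matrix_vector_mult_diff_rdistrib inner_diff_right)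
    qed
  qed
qed

text \<open>The scaling convention bounds \<open>h\<^sub>i = g\<^sub>i + \<omega>\<^sub>i p\<^sub>i\<^sub>-\<^sub>1\<close> but not its two terms. That \<open>g\<^sub>i\<close> and
  \<open>p\<^sub>i\<^sub>-\<^sub>1\<close> are nearly conjugate rules out cancellation between them: pairing with \<open>p\<^sub>i\<^sub>-\<^sub>1\<close> gives a
  linear equation for \<open>\<omega>\<^sub>i\<close> whose coefficient is bounded away from \<open>0\<close> and whose right-hand side is of
  first order.\<close>

lemma g_vanishes:
  assumes i: "i < K"
  shows "vanishes 1 (g i)"
proof -
  have "\<forall>t. \<exists>\<omega>. h i t = g i t + \<omega> *\<^sub>R prev_dir (R t) i" by (metis update_eq)
  then obtain \<omega> where \<omega>: "\<And>t. h i t = g i t + \<omega> t *\<^sub>R prev_dir (R t) i" by metis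
  show ?thesis
  proof (cases i)
    case 0
    then have "h i = g i" using \<omega> by (simp add: prev_dir_def fun_eq_iff)
    then show ?thesis using h_vanishes[OF i] by simp
  next
    case (Suc j)
    have j: "j < K" and ji: "j < i" and iK: "i \<le> K" and jK: "j \<le> K" using i Suc by auto
    have g_eq: "g i t = h i t - \<omega> t *\<^sub>R p j t" for t using \<omega>[of t] Suc by (simp add: prev_dir_def)
    let ?e = "dir_image_error i j"
    let ?P = "\<lambda>t. p j t \<bullet> (N i t *v p j t)"
    let ?b = "\<lambda>t. s j t * (g i t \<bullet> r i t) - a j t * (g i t \<bullet> r j t)"
    have e: "vanishes 1 ?e" by (rule dir_image_error_vanishes[OF j iK])
    have orth: "\<forall>\<^sub>F t in F. p j t \<bullet> r i t = 0 \<and> r i t \<bullet> g j t = 0"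
    proof (rule run_fact)
      fix t assume "lanczos_run A B ev v M m K (R t)"
      then interpret lanczos_run A B ev v M m K "R t" .
      show "p j t \<bullet> r i t = 0 \<and> r i t \<bullet> g j t = 0"
        using prev_dir_residual[OF iK] gvec_residual_Suc[OF j] Suc
        by (simp add: prev_dir_def inner_commute)
    qed
    have "vanishes 2 (\<lambda>t. h i t \<bullet> r i t)"
      by (rule vanishes_inner[OF h_vanishes[OF i] r_vanishes[OF iK]]) simp
    then have "vanishes 2 (\<lambda>t. g i t \<bullet> r i t)"
      by (rule vanishes_cong) (use orth in eventually_elim, simp add: g_eq inner_diff_left)
    then have b1: "vanishes 2 (\<lambda>t. s j t * (g i t \<bullet> r i t))"
      by (rule vanishes_mult[OF s_bounded[OF j]]) simp
    have "vanishes 3 (\<lambda>t. g i t \<bullet> r j t)"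
      using gvec_residual_swap[OF ji i] by (rule vanishes_cong) (use orth in eventually_elim, simp)
    then have b2: "vanishes 2 (\<lambda>t. a j t * (g i t \<bullet> r j t))"
      by (rule vanishes_mult[OF a_bounded[OF j]]) simp
    have "vanishes (1 + 1) ?b" using vanishes_diff[OF b1 b2] by (simp only: one_add_one)
    then have b: "vanishes 1 (\<lambda>t. ?b t / d j t)" by (rule vanishes_divide[OF d_exceeds[OF j]])
    have Nh: "vanishes 1 (\<lambda>t. N i t *v h i t)"
      by (rule vanishes_matrix_vector[OF N_bounded[OF iK] h_vanishes[OF i]]) simp
    have "vanishes 1 (\<lambda>t. p j t \<bullet> (N i t *v h i t) - h i t \<bullet> ?e t - ?b t / d j t)"
      by (intro vanishes_diff b vanishes_inner[OF p_bounded[OF j] Nh]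
          vanishes_inner[OF h_vanishes[OF i] e]) auto
    moreover have "\<forall>\<^sub>F t in F. (?P t - p j t \<bullet> ?e t) *\<^sub>R \<omega> t
        = p j t \<bullet> (N i t *v h i t) - h i t \<bullet> ?e t - ?b t / d j t"
    proof (intro always_eventually allI)
      fix t
      have h_eq: "h i t = g i t + \<omega> t *\<^sub>R p j t" by (simp add: g_eq)
      have "p j t \<bullet> (N i t *v g i t) = g i t \<bullet> (N i t *v p j t)"
        by (metis shifted_inner inner_commute)
      also have "\<dots> = ?b t / d j t + g i t \<bullet> ?e t"
        using inner_dir_image[where u = "g i t" and i = i and j = j and t = t] Suc by simp
      finally show "(?P t - p j t \<bullet> ?e t) *\<^sub>R \<omega> t
          = p j t \<bullet> (N i t *v h i t) - h i t \<bullet> ?e t - ?b t / d j t"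
        by (simp add: h_eq matrix_vector_right_distrib matrix_vector_mult_scaleR inner_add_right
            inner_add_left algebra_simps)
    qed
    ultimately have "vanishes 1 (\<lambda>t. (?P t - p j t \<bullet> ?e t) *\<^sub>R \<omega> t)" by (rule vanishes_cong)
    then have num: "vanishes (0 + 1) (\<lambda>t. (?P t - p j t \<bullet> ?e t) *\<^sub>R \<omega> t)" by simp
    have "vanishes (Suc 0) (\<lambda>t. p j t \<bullet> ?e t)"
      by (rule vanishes_inner[OF p_bounded[OF j] e]) simp
    then have "exceeds 0 (\<lambda>t. ?P t - p j t \<bullet> ?e t)"
      by (rule exceeds_diff[OF p_form_exceeds[OF j iK d_exceeds[OF j]]])
    then have "vanishes 1 \<omega>" using num by (rule vanishes_cancel)
    then have "vanishes 1 (\<lambda>t. h i t - \<omega> t *\<^sub>R p j t)"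
      by (intro vanishes_diff h_vanishes[OF i] vanishes_scaleR[OF _ p_bounded[OF j]]) auto
    then show ?thesis by (simp add: g_eq)
  qed
qed

definition nearly_conjugate :: "nat \<Rightarrow> nat \<Rightarrow> bool" where
  "nearly_conjugate i j \<longleftrightarrow> vanishes 1 (\<lambda>t. p i t \<bullet> (N i t *v p j t))"

text \<open>By construction \<open>p\<^sub>j\<^sub>+\<^sub>1\<close> is exactly conjugate to \<open>p\<^sub>j\<close> for the shift of step \<open>j\<close>.\<close>

lemma nearly_conjugate_consecutive:
  assumes i: "Suc j < K"
  shows "nearly_conjugate (Suc j) j"
proof -
  have j: "j < K" and iK: "Suc j \<le> K" and jK: "j \<le> K" using i by auto
  have "vanishes 2 (\<lambda>t. (N (Suc j) t - N j t) *v p j t)"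
    by (rule vanishes_matrix_vector[OF N_diff_vanishes[OF iK jK] p_bounded[OF j]]) simp
  then have "vanishes 1 (\<lambda>t. p (Suc j) t \<bullet> ((N (Suc j) t - N j t) *v p j t))"
    by (rule vanishes_inner[OF p_bounded[OF i]]) simp
  then show ?thesis unfolding nearly_conjugate_def
  proof (rule vanishes_cong)
    show "\<forall>\<^sub>F t in F. p (Suc j) t \<bullet> (N (Suc j) t *v p j t)
        = p (Suc j) t \<bullet> ((N (Suc j) t - N j t) *v p j t)"
      using runs exceeds_nonzero[OF p_form_exceeds[OF j jK d_exceeds[OF j]]]
    proof eventually_elim
      case (elim t)
      interpret lanczos_run A B ev v M m K "R t" by fact
      have "p j t \<bullet> (N j t *v p (Suc j) t) = 0"
        using conjugate_prev_dir[of "Suc j"] i elim(2) by simp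
      then have "p (Suc j) t \<bullet> (N j t *v p j t) = 0" by (metis shifted_inner inner_commute)
      then show ?case by (simp add: matrix_vector_mult_diff_rdistrib inner_diff_right)
    qed
  qed
qed

text \<open>The combination of residuals that approximates \<open>N p\<^sub>j\<close> has coefficients of order \<open>-1\<close>, so
  \<open>g\<^sup>T N p\<^sub>j\<close> is of second order when the products of \<open>g\<close> with the earlier residuals are of third.
  Normalizing the new direction, whose length has exact order 1, loses one order.\<close>

lemma nearly_conjugate_step:
  assumes i: "Suc l < K" and "j < l"
    and prev: "nearly_conjugate l j"
    and rg: "\<And>i'. i' < Suc l \<Longrightarrow> vanishes 3 (\<lambda>t. r (Suc l) t \<bullet> g i' t)"
  shows "nearly_conjugate (Suc l) j"
proof -
  let ?i = "Suc l"
  have l: "l < K" and lK: "l \<le> K" and iK: "?i \<le> K" and j: "j < K" and jK: "j \<le> K"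
    using assms by auto
  let ?\<beta> = "\<lambda>t. p l t \<bullet> (N l t *v g ?i t) / (p l t \<bullet> (N l t *v p l t))"
  have g_r: "vanishes 3 (\<lambda>t. g ?i t \<bullet> r i' t)" if "i' < ?i" for i'
    using vanishes_add[OF gvec_residual_swap[OF that i] rg[OF that]] by simp
  let ?b = "\<lambda>t. s j t * (g ?i t \<bullet> r (Suc j) t) - a j t * (g ?i t \<bullet> r j t)"
  have "vanishes 3 ?b"
    by (intro vanishes_diff vanishes_mult[OF s_bounded[OF j] g_r] vanishes_mult[OF a_bounded[OF j] g_r])
      (use \<open>j < l\<close> in auto)
  moreover have "(3::nat) = 1 + 2" by simp
  ultimately have "vanishes (1 + 2) ?b" by (simp only:)
  then have "vanishes 2 (\<lambda>t. ?b t / d j t)" by (rule vanishes_divide[OF d_exceeds[OF j]])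
  moreover have "vanishes 2 (\<lambda>t. g ?i t \<bullet> dir_image_error ?i j t)"
    by (rule vanishes_inner[OF g_vanishes[OF i] dir_image_error_vanishes[OF j iK]]) simp
  ultimately have gNp: "vanishes 2 (\<lambda>t. g ?i t \<bullet> (N ?i t *v p j t))"
    unfolding inner_dir_image by (rule vanishes_add)
  have "vanishes 1 (\<lambda>t. N l t *v g ?i t)"
    by (rule vanishes_matrix_vector[OF N_bounded[OF lK] g_vanishes[OF i]]) simp
  then have "vanishes (0 + 1) (\<lambda>t. p l t \<bullet> (N l t *v g ?i t))"
    by (rule vanishes_inner[OF p_bounded[OF l]]) simp
  then have \<beta>: "vanishes 1 ?\<beta>" by (rule vanishes_divide[OF p_form_exceeds[OF l lK d_exceeds[OF l]]])
  have "vanishes 2 (\<lambda>t. (N ?i t - N l t) *v p j t)"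
    by (rule vanishes_matrix_vector[OF N_diff_vanishes[OF iK lK] p_bounded[OF j]]) simp
  then have "vanishes 1 (\<lambda>t. p l t \<bullet> ((N ?i t - N l t) *v p j t))"
    by (rule vanishes_inner[OF p_bounded[OF l]]) simp
  then have "vanishes 1 (\<lambda>t. p l t \<bullet> (N l t *v p j t) + p l t \<bullet> ((N ?i t - N l t) *v p j t))"
    using prev unfolding nearly_conjugate_def by (rule vanishes_add[rotated])
  then have "vanishes 1 (\<lambda>t. p l t \<bullet> (N ?i t *v p j t))"
    by (simp add: matrix_vector_mult_diff_rdistrib inner_diff_right)
  then have "vanishes 2 (\<lambda>t. ?\<beta> t * (p l t \<bullet> (N ?i t *v p j t)))" by (rule vanishes_mult[OF \<beta>]) simp
  with gNp have "vanishes 2 (\<lambda>t. g ?i t \<bullet> (N ?i t *v p j t) - ?\<beta> t * (p l t \<bullet> (N ?i t *v p j t)))"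
    by (rule vanishes_diff)
  then have "vanishes 2 (\<lambda>t. d ?i t *\<^sub>R (p ?i t \<bullet> (N ?i t *v p j t)))"
  proof (rule vanishes_cong)
    show "\<forall>\<^sub>F t in F. d ?i t *\<^sub>R (p ?i t \<bullet> (N ?i t *v p j t))
        = g ?i t \<bullet> (N ?i t *v p j t) - ?\<beta> t * (p l t \<bullet> (N ?i t *v p j t))"
    proof (rule run_fact)
      fix t assume "lanczos_run A B ev v M m K (R t)"
      then interpret lanczos_run A B ev v M m K "R t" .
      have "d ?i t *\<^sub>R (p ?i t \<bullet> (N ?i t *v p j t)) = dir_unnorm A B (R t) ?i \<bullet> (N ?i t *v p j t)"
        using arg_cong[OF dir_unnorm_eq[OF i], of "\<lambda>u. u \<bullet> (N ?i t *v p j t)"] by simp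
      then show "d ?i t *\<^sub>R (p ?i t \<bullet> (N ?i t *v p j t))
          = g ?i t \<bullet> (N ?i t *v p j t) - ?\<beta> t * (p l t \<bullet> (N ?i t *v p j t))"
        by (simp add: dir_unnorm_def inner_diff_left)
    qed
  qed
  then have "vanishes (1 + 1) (\<lambda>t. d ?i t *\<^sub>R (p ?i t \<bullet> (N ?i t *v p j t)))" by (simp only: one_add_one)
  then show ?thesis unfolding nearly_conjugate_def by (rule vanishes_cancel[OF d_exceeds[OF i]])
qed

lemma approx_conjugate_iff:
  "i < K \<Longrightarrow> approx_conjugate F A B (v 1) R i \<longleftrightarrow> (\<forall>i'\<le>i. \<forall>j<i'. nearly_conjugate i' j)"
proof -
  assume "i < K"
  have "(\<lambda>t. p i' t \<bullet> (N i' t *v p j t)) \<in> O[F](\<lambda>t. sin (\<theta> j t)) \<longleftrightarrow> nearly_conjugate i' j"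
    if "j \<le> K" for i' j
    unfolding nearly_conjugate_def
    using vanishes_in_bigo[OF _ sin_exceeds[OF that]] vanishes_from_bigo[OF _ sin_vanishes[OF that]]
    by blast
  then show ?thesis using \<open>i < K\<close> by (auto simp: approx_conjugate_def)
qed

lemma approx_conjugate_0: "approx_conjugate F A B (v 1) R 0"
  by (simp add: approx_conjugate_def)

lemma approx_conjugate_Suc:
  assumes i: "Suc l < K" and "approx_conjugate F A B (v 1) R l"
    and "\<And>j. j < Suc l \<Longrightarrow> vanishes 3 (\<lambda>t. r (Suc l) t \<bullet> g j t)"
  shows "approx_conjugate F A B (v 1) R (Suc l)"
proof -
  have prev: "nearly_conjugate i' j" if "i' \<le> l" "j < i'" for i' j
    using assms(2) approx_conjugate_iff[of l] i that by auto
  have "nearly_conjugate i' j" if "i' \<le> Suc l" "j < i'" for i' j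
  proof (cases "i' \<le> l")
    case False
    then have i': "i' = Suc l" using that by simp
    show ?thesis
    proof (cases "j = l")
      case True
      then show ?thesis using nearly_conjugate_consecutive i i' by simp
    next
      case False
      then have "j < l" using that i' by simp
      then show ?thesis unfolding i' using prev assms(3) by (intro nearly_conjugate_step[OF i]) auto
    qed
  qed (use prev that in auto)
  then show ?thesis using approx_conjugate_iff[OF i] by blast
qed

text \<open>For the first two directions the products \<open>r\<^sub>i\<^sup>T g\<^sub>j\<close> are zero, because \<open>r\<^sub>1\<close> is orthogonal to the
  trial space of step 0 and \<open>r\<^sub>2\<close> to that of step 1, which contains \<open>g\<^sub>0\<close> and \<open>g\<^sub>1\<close>.\<close>

lemma approx_conjugate_2:
  assumes K: "2 < K"
  shows "approx_conjugate F A B (v 1) R 2"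
proof -
  have zero: "vanishes 3 (\<lambda>t. r (Suc j) t \<bullet> g j t)" if "j < K" for j
    by (rule vanishes_cong[OF vanishes_zero], rule run_fact)
      (use lanczos_run.gvec_residual_Suc[OF _ that] in \<open>simp add: inner_commute\<close>)
  have zero2: "vanishes 3 (\<lambda>t. r 2 t \<bullet> g 0 t)"
  proof (rule vanishes_cong[OF vanishes_zero], rule run_fact)
    fix t assume "lanczos_run A B ev v M m K (R t)"
    then have "g 0 t \<bullet> r 2 t = 0" using K by (intro lanczos_run.gvec_0_residual_2) auto
    then show "r 2 t \<bullet> g 0 t = 0" by (simp add: inner_commute)
  qed
  have "approx_conjugate F A B (v 1) R (Suc 0)"
    by (rule approx_conjugate_Suc[OF _ approx_conjugate_0]) (use K zero in \<open>auto simp: less_Suc_eq\<close>)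
  then have "approx_conjugate F A B (v 1) R (Suc (Suc 0))"
    by (rule approx_conjugate_Suc[rotated])
      (use K zero[of 1] zero2 in \<open>auto simp: less_Suc_eq numeral_2_eq_2\<close>)
  then show ?thesis by (simp add: numeral_2_eq_2)
qed

text \<open>One order each comes from the cosine, the residual and \<open>g\<^sub>j\<close>.\<close>

lemma residual_gvec_vanishes:
  assumes "(\<lambda>t. cos (subspace_angle (r i t) (Wspace (R t) i))) \<in> O[F](eps)" and i: "i \<le> K" and "j < i"
  shows "vanishes 3 (\<lambda>t. r i t \<bullet> g j t)"
proof -
  have jK: "j < K" using assms by simp
  have "vanishes 1 (\<lambda>t. cos (subspace_angle (r i t) (Wspace (R t) i)))"
    by (rule vanishes_from_bigo[OF _ vanishes_parameter]) (use assms(1) in simp)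
  moreover have "vanishes 2 (\<lambda>t. norm (r i t) * norm (g j t))"
    by (rule vanishes_mult[OF vanishes_norm[THEN iffD2, OF r_vanishes[OF i]]
          vanishes_norm[THEN iffD2, OF g_vanishes[OF jK]]]) simp
  ultimately have "vanishes 3 (\<lambda>t. cos (subspace_angle (r i t) (Wspace (R t) i)) * (norm (r i t) * norm (g j t)))"
    by (rule vanishes_mult) simp
  then show ?thesis
  proof (rule vanishes_bound[where C = 1])
    show "\<forall>\<^sub>F t in F. norm (r i t \<bullet> g j t)
        \<le> 1 * norm (cos (subspace_angle (r i t) (Wspace (R t) i)) * (norm (r i t) * norm (g j t)))"
      using inner_le_cos_subspace_angle[OF subspace_Wspace gvec_in_Wspace[OF \<open>j < i\<close>]]
      by (intro always_eventually allI) (simp add: abs_mult)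
  qed
qed

end

section \<open>Global quasi-optimality\<close>

locale lanczos_minimizers = lanczos_family A B ev v M m K F R \<xi>l \<xi>u
  for A B :: "real^'n^'n" and ev v M m K and F :: "'i filter" and R \<xi>l \<xi>u +
  fixes y :: "'i \<Rightarrow> nat \<Rightarrow> real^'n" and C :: "nat \<Rightarrow> real"
  assumes K_ge: "K \<ge> 3"
    and minimizers: "\<forall>\<^sub>F t in F. \<forall>j\<le>K. rayleigh_minimizer A B (Uspace (R t) j) (y t j)"
    and differentiable:
      "3 \<le> j \<Longrightarrow> j < K \<Longrightarrow> differentiability_assumption F A B (ev 1) (v 1) R y j"
    and recursion: "2 \<le> j \<Longrightarrow> j < K \<Longrightarrow> approx_conjugate F A B (v 1) R j \<Longrightarrow>
      \<forall>\<^sub>F t in F. rho A B (R t) (j + 1) - rayleigh A B (y t (j + 1))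
        \<le> rho A B (R t) j - rayleigh A B (y t j)
           + C (j + 1) * sin (theta B (v 1) (R t) (j + 1)) * (sin (theta B (v 1) (R t) 0))\<^sup>2"
begin

abbreviation "excess j t \<equiv> rho A B (R t) j - rayleigh A B (y t j)"
abbreviation "excess_bound j t \<equiv> \<Sum>i=3..j. C i * sin (\<theta> i t) * (sin (\<theta> 0 t))\<^sup>2"

lemma excess_nonneg:
  assumes "j \<le> K"
  shows "\<forall>\<^sub>F t in F. 0 \<le> excess j t"
  using runs minimizers
proof eventually_elim
  case (elim t)
  interpret lanczos_run A B ev v M m K "R t" by fact
  show ?case
    using elim(2) assms iter_in_Uspace[OF assms] iter_nonzero[OF assms]
    by (auto simp: rayleigh_minimizer_def)
qed

lemma excess_2: "\<forall>\<^sub>F t in F. excess 2 t \<le> 0"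
proof -
  have "0 < K" and K: "1 < K" "2 \<le> K" using K_ge by auto
  show ?thesis
    using runs minimizers exceeds_nonzero[OF a_exceeds[OF \<open>0 < K\<close>]]
  proof eventually_elim
    case (elim t)
    interpret lanczos_run A B ev v M m K "R t" by fact
    have "rayleigh_minimizer A B (Uspace (R t) 2) (y t 2)" using elim(2) K by blast
    then show ?case
      using rho_2_le[OF K(1) elim(3)] by (simp add: rayleigh_minimizer_def)
  qed
qed

lemma excess_bound_vanishes:
  assumes "j \<le> K"
  shows "vanishes 3 (excess_bound j)"
proof (rule vanishes_sum)
  fix i assume "i \<in> {3..j}"
  then have i: "i \<le> K" using assms by simp
  have "vanishes 1 (\<lambda>t. C i * sin (\<theta> i t))"
    by (rule vanishes_mult[OF vanishes_const sin_vanishes[OF i]]) simp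
  moreover have "vanishes 2 (\<lambda>t. (sin (\<theta> 0 t))\<^sup>2)"
    unfolding power2_eq_square by (rule vanishes_mult[OF sin_vanishes sin_vanishes]) auto
  ultimately show "vanishes 3 (\<lambda>t. C i * sin (\<theta> i t) * (sin (\<theta> 0 t))\<^sup>2)"
    by (rule vanishes_mult) simp
qed

text \<open>The bound is of third order and the eigenvalue error of exact order 2.\<close>

lemma quasi_optimal_if_bounded:
  assumes j: "j \<le> K" and "\<forall>\<^sub>F t in F. excess j t \<le> excess_bound j t"
  shows "quasi_optimal F A B (ev 1) R y j"
proof -
  have "vanishes 3 (excess j)"
  proof (rule vanishes_bound[OF excess_bound_vanishes[OF j]])
    show "\<forall>\<^sub>F t in F. norm (excess j t) \<le> 1 * norm (excess_bound j t)"
      using assms(2) excess_nonneg[OF j]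
      by eventually_elim simp
  qed
  moreover have "(3::nat) = 2 + 1" by simp
  ultimately have "vanishes (2 + 1) (excess j)" by (simp only:)
  then have "vanishes 1 (\<lambda>t. excess j t / (rho A B (R t) j - ev 1))"
    by (rule vanishes_divide[OF rho_exceeds[OF j]])
  then show ?thesis unfolding quasi_optimal_def One_nat_def by (rule vanishes_tendsto_0)
qed

text \<open>The two claims feed each other: conjugacy up to step \<open>j\<close> yields the bound at \<open>j + 1\<close>, the bound
  makes \<open>x\<^sub>j\<^sub>+\<^sub>1\<close> quasi-optimal, and quasi-optimality makes \<open>r\<^sub>j\<^sub>+\<^sub>1\<close> nearly orthogonal to \<open>W\<^sub>j\<^sub>+\<^sub>1\<close>, which
  extends conjugacy to \<open>p\<^sub>j\<^sub>+\<^sub>1\<close>.\<close>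

lemma excess_le_and_conjugate:
  assumes "2 \<le> j"
  shows "j \<le> K \<Longrightarrow> (\<forall>\<^sub>F t in F. excess j t \<le> excess_bound j t) \<and>
    (j < K \<longrightarrow> approx_conjugate F A B (v 1) R j)"
  using assms
proof (induction j rule: nat_induct_at_least)
  case base
  show ?case using excess_2 approx_conjugate_2 by simp
next
  case (Suc j)
  have j: "j < K" and SK: "Suc j \<le> K" using Suc.prems by auto
  have IH: "\<forall>\<^sub>F t in F. excess j t \<le> excess_bound j t" "approx_conjugate F A B (v 1) R j"
    using Suc.IH j by auto
  have "\<forall>\<^sub>F t in F. excess (Suc j) t
      \<le> excess j t + C (Suc j) * sin (\<theta> (Suc j) t) * (sin (\<theta> 0 t))\<^sup>2"
    using recursion[OF Suc.hyps j IH(2)] by simp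
  with IH(1) have bound: "\<forall>\<^sub>F t in F. excess (Suc j) t \<le> excess_bound (Suc j) t"
    by eventually_elim (use Suc.hyps in \<open>simp add: sum.nat_ivl_Suc'\<close>)
  have "approx_conjugate F A B (v 1) R (Suc j)" if "Suc j < K"
  proof (rule approx_conjugate_Suc[OF that IH(2)])
    fix i assume "i < Suc j"
    have "differentiability_assumption F A B (ev 1) (v 1) R y (Suc j)"
      using Suc.hyps that by (intro differentiable) auto
    then have "(\<lambda>t. cos (subspace_angle (r (Suc j) t) (Wspace (R t) (Suc j)))) \<in> O[F](eps)"
      using quasi_optimal_if_bounded[OF SK bound]
      by (simp add: differentiability_assumption_def eps_def[abs_def])
    then show "vanishes 3 (\<lambda>t. r (Suc j) t \<bullet> g i t)"
      using SK \<open>i < Suc j\<close> by (rule residual_gvec_vanishes)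
  qed
  with bound show ?case by blast
qed

end

theorem theorem11:
  fixes A B M :: "real^'n^'n"
    and ev :: "nat \<Rightarrow> real" and v :: "nat \<Rightarrow> real^'n"
    and m k :: nat
    and F :: "'i filter" and R :: "'i \<Rightarrow> 'n run"
    and f0 :: "'i \<Rightarrow> real^'n" and y :: "'i \<Rightarrow> nat \<Rightarrow> real^'n"
    and \<xi>l \<xi>u :: real and C :: "nat \<Rightarrow> real"
  assumes "transpose A = A" and "spd B" and "spd M" and "m > 0"
    and "CARD('n) \<ge> 2"
    and "pencil_eigensystem A B ev v"
    and "ev 1 < ev 2" and "\<forall>i j. 2 \<le> i \<and> i \<le> j \<and> j \<le> CARD('n) \<longrightarrow> ev i \<le> ev j"
    and "k \<ge> 3"
    and "filterlim (\<lambda>t. theta B (v 1) (R t) 0) (at_right 0) F"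
    and "\<forall>\<^sub>F t in F. lanczos_plus_one A B M m k (R t)"
    and "scaling_convention F B R k"
    and "\<forall>\<^sub>F t in F.
           iter (R t) 0 = cos (theta B (v 1) (R t) 0) *\<^sub>R v 1 + sin (theta B (v 1) (R t) 0) *\<^sub>R f0 t \<and>
           f0 t \<bullet> (B *v v 1) = 0 \<and> norm_in B (f0 t) = 1"
    and "\<forall>\<^sub>F t in F. \<forall>j\<le>k. rayleigh_minimizer A B (Uspace (R t) j) (y t j)"
    and "linear_convergence F A B (ev 1) (ev 2) \<xi>l \<xi>u R k"
    and "angle_assumption F (v 1) R k"
    and "polynomial_assumption F A B M m (v 1) R k"
    and "\<forall>j. 3 \<le> j \<and> j < k \<longrightarrow> differentiability_assumption F A B (ev 1) (v 1) R y j"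
    and "\<forall>j. 2 \<le> j \<and> j < k \<longrightarrow> approx_conjugate F A B (v 1) R j \<longrightarrow>
           (\<forall>\<^sub>F t in F.
              rho A B (R t) (j + 1) - rayleigh A B (y t (j + 1))
                \<le> rho A B (R t) j - rayleigh A B (y t j)
                   + C (j + 1) * sin (theta B (v 1) (R t) (j + 1)) * (sin (theta B (v 1) (R t) 0))\<^sup>2)"
  shows "(\<forall>\<^sub>F t in F.
            rho A B (R t) k - rayleigh A B (y t k)
              \<le> (\<Sum>j=3..k. C j * sin (theta B (v 1) (R t) j) * (sin (theta B (v 1) (R t) 0))\<^sup>2)) \<and>
         (\<exists>L1 L2 L3.
            ((\<lambda>t. (rho A B (R t) k - rayleigh A B (y t k)) / (rho A B (R t) k - ev 1)) \<longlongrightarrow> L1) F \<and>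
            ((\<lambda>t. (\<Sum>j=3..k. C j * sin (theta B (v 1) (R t) j) * (sin (theta B (v 1) (R t) 0))\<^sup>2) /
                  (\<xi>l ^ k * (rayleigh A B (f0 t) - ev 1) * (sin (theta B (v 1) (R t) 0))\<^sup>2)) \<longlongrightarrow> L2) F \<and>
            ((\<lambda>t. (inverse \<xi>l) ^ k * (\<Sum>j=3..k. C j * sin (theta B (v 1) (R t) j)) /
                  (ev 2 - ev 1)) \<longlongrightarrow> L3) F \<and>
            L1 \<le> L2 \<and> L2 \<le> L3 \<and> L3 = 0)"
proof -
  interpret lanczos_minimizers A B ev v M m k F R \<xi>l \<xi>u y C
    by unfold_locales (use assms in auto)
  have bound: "\<forall>\<^sub>F t in F. excess k t \<le> excess_bound k t"
    using excess_le_and_conjugate[of k] K_ge by auto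
  have L1: "((\<lambda>t. excess k t / (rho A B (R t) k - ev 1)) \<longlongrightarrow> 0) F"
    using quasi_optimal_if_bounded[OF order_refl bound] by (simp add: quasi_optimal_def)
  \<comment> \<open>\<open>\<rho>(f\<^sub>0) \<ge> \<lambda>\<^sub>2\<close> as \<open>f\<^sub>0\<close> is \<open>B\<close>-orthogonal to \<open>v\<^sub>1\<close>; so the denominator has exact order 2.\<close>
  have L2: "((\<lambda>t. excess_bound k t / (\<xi>l ^ k * (rayleigh A B (f0 t) - ev 1) * (sin (\<theta> 0 t))\<^sup>2)) \<longlongrightarrow> 0) F"
  proof (rule vanishes_tendsto_0[where n = 0], rule vanishes_divide[where m = 2])
    show "exceeds 2 (\<lambda>t. \<xi>l ^ k * (rayleigh A B (f0 t) - ev 1) * (sin (\<theta> 0 t))\<^sup>2)"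
    proof (rule exceedsI)
      show "0 < \<xi>l ^ k * (ev 2 - ev 1)" using \<xi>l_pos gap by simp
      show "\<forall>\<^sub>F t in F. \<xi>l ^ k * (ev 2 - ev 1) * (eps t)\<^sup>2
          \<le> norm (\<xi>l ^ k * (rayleigh A B (f0 t) - ev 1) * (sin (\<theta> 0 t))\<^sup>2)"
        using assms(13)
      proof eventually_elim
        case (elim t)
        have "f0 t \<noteq> 0" using elim norm_in_eq_0_iff[OF spd_B, of "f0 t"] by auto
        then have "ev 2 \<le> rayleigh A B (f0 t)" using elim by (intro rayleigh_ge_ev2) auto
        then have "\<xi>l ^ k * (ev 2 - ev 1) * (eps t)\<^sup>2 \<le> \<xi>l ^ k * (rayleigh A B (f0 t) - ev 1) * (eps t)\<^sup>2"
          using \<xi>l_pos by (intro mult_right_mono mult_left_mono) auto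
        then show ?case unfolding eps_def real_norm_def using abs_ge_self by (rule order_trans)
      qed
    qed
    have "(3::nat) = 2 + Suc 0" by simp
    then show "vanishes (2 + Suc 0) (excess_bound k)"
      using excess_bound_vanishes[OF order_refl] by (simp only:)
  qed
  have L3: "((\<lambda>t. (inverse \<xi>l) ^ k * (\<Sum>j=3..k. C j * sin (\<theta> j t)) / (ev 2 - ev 1)) \<longlongrightarrow> 0) F"
  proof (rule vanishes_tendsto_0[where n = 0])
    have sum: "vanishes (Suc 0) (\<lambda>t. \<Sum>j=3..k. C j * sin (\<theta> j t))"
      by (intro vanishes_sum vanishes_mult[OF vanishes_const sin_vanishes]) auto
    have "vanishes (Suc 0) (\<lambda>t. ((inverse \<xi>l) ^ k / (ev 2 - ev 1)) * (\<Sum>j=3..k. C j * sin (\<theta> j t)))"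
      by (rule vanishes_mult[OF vanishes_const sum]) simp
    then show "vanishes (Suc 0) (\<lambda>t. (inverse \<xi>l) ^ k * (\<Sum>j=3..k. C j * sin (\<theta> j t)) / (ev 2 - ev 1))"
      by simp
  qed
  show ?thesis using bound L1 L2 L3 by blast
qed

end
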